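(* Let $\mathcal{M}$ be a Riemannian manifold with boundary and outward unit normal $n$, and let $Q=\{c\in C^\infty(\mathcal{M}):c\ge0,\ \int_{\mathcal{M}}c\,dV=1\}$ be the space of (smooth) probability densities equipped with the Wasserstein inner product, defined for tangent vectors $\mathring c_1,\mathring c_2\in T_cQ$ by $$W(\mathring c_1,\mathring c_2)=\int_{\mathcal{M}}c\,\nabla C_1\cdot\nabla C_2\,dV,\qquad\text{where } -\nabla\cdot(c\nabla C_k)=\mathring c_k,\quad \partial_nC_k=0\text{ on }\partial\mathcal{M},\quad k=1,2.$$ For any free energy $\mathcal{F}:Q\to\mathbb{R}$, Onsager's variational principle with $$E_c=\{w\in\Gamma(T\mathcal{M}):w\cdot n=0\text{ on }\partial\mathcal{M}\},\qquad \mathcal{D}_c(w)=\frac12\int_{\mathcal{M}}c|w|^2\,dV,\qquad \mathcal{P}_cw=-\nabla\cdot(c\,w)$$ recovers the corresponding Wasserstein gradient flow: $$\dot c=-\mathrm{grad}_W\mathcal{F}\big|_c=\nabla\cdot\big(c\,\nabla\,\mathrm{grad}_{L^2}\mathcal{F}|_c\big).$$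
   Context: $\Gamma(T\mathcal{M})$ denotes smooth vector fields, and $T_cQ=\{\mathring c\in C^\infty(\mathcal{M}):\int_{\mathcal{M}}\mathring c\,dV=0\}$. Onsager's variational principle (OVP): a differentiable curve $t\mapsto c(t)\in Q$ is a solution if for every $t$, $\dot c(t)=\mathcal{P}_{c(t)}v(t)$, where $v(t)$ minimizes the Rayleighian $\mathcal{R}_c(w)=\langle d\mathcal{F}_c\,|\,\mathcal{P}_cw\rangle+\mathcal{D}_c(w)$ over $w\in E_c$ at $c=c(t)$; "recovers" means that every solution of OVP satisfies the displayed equations. The gradients are defined by $\langle d\mathcal{F}_c\,|\,\mathring c\rangle=\int_{\mathcal{M}}(\mathrm{grad}_{L^2}\mathcal{F}|_c)\,\mathring c\,dV$ and $\langle d\mathcal{F}_c\,|\,\mathring c\rangle=W(\mathrm{grad}_W\mathcal{F}|_c,\mathring c)$ for all $\mathring c\in T_cQ$, with $\mathrm{grad}_{L^2}\mathcal{F}|_c\in C^\infty(\mathcal{M})$ determined up to an additive constant and $\mathrm{grad}_W\mathcal{F}|_c\in T_cQ$. Standing conventions: $\mathcal{M}$ is compact, $\mathcal{F}$ is differentiable and both gradients exist at the densities considered, and the Neumann problem $-\nabla\cdot(c\nabla C)=\mathring c$, $\partial_nC=0$ is solvable for every $\mathring c\in T_cQ$ (so that $W$ is defined). *)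

theory Defs
  imports "HOL-Analysis.Analysis"
begin

section \<open>Smooth functions on subsets of Euclidean space\<close>

text \<open>Derivatives are taken within \<open>S\<close>. This is only used for relatively open subsets \<open>S\<close> of a closed
  half-space, where they are unique; at points of the bounding hyperplane they are the one-sided
  derivatives, so that \<open>smooth_on S f\<close> is smoothness up to the boundary.\<close>

primrec ck_on :: "nat \<Rightarrow> 'a::euclidean_space set \<Rightarrow> ('a \<Rightarrow> 'b::real_normed_vector) \<Rightarrow> bool" where
  "ck_on 0 S f \<longleftrightarrow> continuous_on S f"
| "ck_on (Suc k) S f \<longleftrightarrow> f differentiable_on S \<and>
     (\<forall>e\<in>Basis. ck_on k S (\<lambda>x. frechet_derivative f (at x within S) e))"

definition smooth_on :: "'a::euclidean_space set \<Rightarrow> ('a \<Rightarrow> 'b::real_normed_vector) \<Rightarrow> bool" where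
  "smooth_on S f \<longleftrightarrow> (\<forall>k. ck_on k S f)"


section \<open>Smooth manifolds with boundary\<close>

text \<open>The model space is the half-space of \<open>\<real>\<^sup>n\<close> on which one fixed coordinate is nonnegative. The
  manifold is the whole type \<open>'m\<close>, of dimension \<open>CARD('n)\<close>; it need not be connected.\<close>

definition bdry_coord :: "'n::finite" where
  "bdry_coord = (SOME k. True)"

definition half_space :: "(real^'n::finite) set" where
  "half_space = {x. 0 \<le> x $ bdry_coord}"

type_synonym ('m, 'n) chart = "'m set \<times> ('m \<Rightarrow> real^'n)"

definition chart_image :: "('m, 'n::finite) chart \<Rightarrow> (real^'n) set" where
  "chart_image a = snd a ` fst a"

definition chart_inv :: "('m, 'n::finite) chart \<Rightarrow> real^'n \<Rightarrow> 'm" where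
  "chart_inv a = the_inv_into (fst a) (snd a)"

definition is_chart :: "('m::topological_space, 'n::finite) chart \<Rightarrow> bool" where
  "is_chart a \<longleftrightarrow> open (fst a) \<and> openin (top_of_set half_space) (chart_image a) \<and>
     inj_on (snd a) (fst a) \<and> homeomorphism (fst a) (chart_image a) (snd a) (chart_inv a)"

text \<open>The atlas need not be maximal; all notions below depend only on the smooth structure that
  it generates.\<close>

definition smooth_atlas :: "('m::topological_space, 'n::finite) chart set \<Rightarrow> bool" where
  "smooth_atlas A \<longleftrightarrow> (\<forall>a\<in>A. is_chart a) \<and> (\<Union>a\<in>A. fst a) = UNIV \<and>
     (\<forall>a\<in>A. \<forall>b\<in>A. smooth_on (snd a ` (fst a \<inter> fst b)) (snd b \<circ> chart_inv a))"

text \<open>The volume measure and the outward unit normal are determined by the atlas and the metric (the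
  normal is relevant on the boundary only); the predicate \<open>riemannian_manifold\<close> below ties them
  together.\<close>

record ('m, 'n) riem =
  atlas :: "('m, 'n) chart set"
  metric :: "'m \<Rightarrow> real^'n \<Rightarrow> real^'n \<Rightarrow> real"
  vol :: "'m measure"
  normal :: "'m \<Rightarrow> real^'n"

text \<open>Every point \<open>p\<close> gets a preferred chart, through which the tangent space at \<open>p\<close> is identified
  with \<open>real^'n\<close>. A vector field is thus a function \<open>'m \<Rightarrow> real^'n\<close>; its coordinate expression in an
  arbitrary chart is obtained by applying the derivative of the transition map.\<close>

definition chart_at :: "('m, 'n::finite, 'z) riem_scheme \<Rightarrow> 'm \<Rightarrow> ('m, 'n) chart" where
  "chart_at M p = (SOME a. a \<in> atlas M \<and> p \<in> fst a)"

definition transition_deriv ::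
    "('m, 'n::finite) chart \<Rightarrow> ('m, 'n) chart \<Rightarrow> 'm \<Rightarrow> real^'n \<Rightarrow> real^'n" where
  "transition_deriv a b p =
     frechet_derivative (snd b \<circ> chart_inv a) (at (snd a p) within snd a ` (fst a \<inter> fst b))"

definition to_chart ::
    "('m, 'n::finite, 'z) riem_scheme \<Rightarrow> ('m, 'n) chart \<Rightarrow> 'm \<Rightarrow> real^'n \<Rightarrow> real^'n" where
  "to_chart M a p = transition_deriv (chart_at M p) a p"

definition from_chart ::
    "('m, 'n::finite, 'z) riem_scheme \<Rightarrow> ('m, 'n) chart \<Rightarrow> 'm \<Rightarrow> real^'n \<Rightarrow> real^'n" where
  "from_chart M a p = transition_deriv a (chart_at M p) p"

definition boundary :: "('m, 'n::finite, 'z) riem_scheme \<Rightarrow> 'm set" where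
  "boundary M = {p. \<exists>a\<in>atlas M. p \<in> fst a \<and> snd a p $ bdry_coord = 0}"

definition smooth_fun :: "('m, 'n::finite, 'z) riem_scheme \<Rightarrow> ('m \<Rightarrow> real) \<Rightarrow> bool" where
  "smooth_fun M f \<longleftrightarrow> (\<forall>a\<in>atlas M. smooth_on (chart_image a) (f \<circ> chart_inv a))"

definition coord_field ::
    "('m, 'n::finite, 'z) riem_scheme \<Rightarrow> ('m, 'n) chart \<Rightarrow> ('m \<Rightarrow> real^'n) \<Rightarrow> real^'n \<Rightarrow> real^'n" where
  "coord_field M a w x = to_chart M a (chart_inv a x) (w (chart_inv a x))"

definition smooth_field :: "('m, 'n::finite, 'z) riem_scheme \<Rightarrow> ('m \<Rightarrow> real^'n) \<Rightarrow> bool" where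
  "smooth_field M w \<longleftrightarrow> (\<forall>a\<in>atlas M. smooth_on (chart_image a) (coord_field M a w))"


section \<open>Riemannian structure\<close>

definition gram ::
    "('m, 'n::finite, 'z) riem_scheme \<Rightarrow> ('m, 'n) chart \<Rightarrow> real^'n \<Rightarrow> real^'n^'n" where
  "gram M a x = (\<chi> i j. metric M (chart_inv a x)
     (from_chart M a (chart_inv a x) (axis i 1)) (from_chart M a (chart_inv a x) (axis j 1)))"

definition vol_density ::
    "('m, 'n::finite, 'z) riem_scheme \<Rightarrow> ('m, 'n) chart \<Rightarrow> real^'n \<Rightarrow> real" where
  "vol_density M a x = sqrt (det (gram M a x))"

definition riemannian_metric :: "('m, 'n::finite, 'z) riem_scheme \<Rightarrow> bool" where
  "riemannian_metric M \<longleftrightarrow>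
     (\<forall>p. bilinear (metric M p) \<and> (\<forall>u v. metric M p u v = metric M p v u) \<and>
          (\<forall>u. u \<noteq> 0 \<longrightarrow> 0 < metric M p u u)) \<and>
     (\<forall>a\<in>atlas M. \<forall>i j. smooth_on (chart_image a) (\<lambda>x. gram M a x $ i $ j))"

definition riemannian_volume :: "('m::topological_space, 'n::finite, 'z) riem_scheme \<Rightarrow> bool" where
  "riemannian_volume M \<longleftrightarrow> sets (vol M) = sets borel \<and>
     (\<forall>a\<in>atlas M. \<forall>B\<in>sets borel. B \<subseteq> fst a \<longrightarrow>
        emeasure (vol M) B = (\<integral>\<^sup>+x\<in>snd a ` B. ennreal (vol_density M a x) \<partial>lborel))"

text \<open>In the preferred chart at a boundary point, the vectors tangent to the boundary are those
  with vanishing boundary coordinate, and the outward ones have negative boundary coordinate.\<close>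

definition outward_unit_normal :: "('m, 'n::finite, 'z) riem_scheme \<Rightarrow> bool" where
  "outward_unit_normal M \<longleftrightarrow> (\<forall>p\<in>boundary M.
     metric M p (normal M p) (normal M p) = 1 \<and> normal M p $ bdry_coord < 0 \<and>
     (\<forall>u. u $ bdry_coord = 0 \<longrightarrow> metric M p (normal M p) u = 0))"

definition riemannian_manifold :: "('m::topological_space, 'n::finite, 'z) riem_scheme \<Rightarrow> bool" where
  "riemannian_manifold M \<longleftrightarrow> smooth_atlas (atlas M) \<and> riemannian_metric M \<and>
     riemannian_volume M \<and> outward_unit_normal M"

definition dfun :: "('m, 'n::finite, 'z) riem_scheme \<Rightarrow> ('m \<Rightarrow> real) \<Rightarrow> 'm \<Rightarrow> real^'n \<Rightarrow> real" where
  "dfun M f p = frechet_derivative (f \<circ> chart_inv (chart_at M p))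
     (at (snd (chart_at M p) p) within chart_image (chart_at M p))"

definition grad :: "('m, 'n::finite, 'z) riem_scheme \<Rightarrow> ('m \<Rightarrow> real) \<Rightarrow> 'm \<Rightarrow> real^'n" where
  "grad M f p = (THE v. \<forall>u. metric M p v u = dfun M f p u)"

text \<open>In coordinates, \<open>div w = (1 / \<surd>(det g)) \<Sum>\<^sub>i \<partial>\<^sub>i (\<surd>(det g) w\<^sup>i)\<close>.\<close>

definition coord_div ::
    "('m, 'n::finite, 'z) riem_scheme \<Rightarrow> ('m, 'n) chart \<Rightarrow> ('m \<Rightarrow> real^'n) \<Rightarrow> real^'n \<Rightarrow> real" where
  "coord_div M a w x = (\<Sum>i\<in>UNIV. frechet_derivative
       (\<lambda>y. vol_density M a y * coord_field M a w y $ i) (at x within chart_image a) (axis i 1))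
     / vol_density M a x"

definition dvg :: "('m, 'n::finite, 'z) riem_scheme \<Rightarrow> ('m \<Rightarrow> real^'n) \<Rightarrow> 'm \<Rightarrow> real" where
  "dvg M w p = coord_div M (chart_at M p) w (snd (chart_at M p) p)"


section \<open>Probability densities and the Wasserstein inner product\<close>

definition densities :: "('m, 'n::finite, 'z) riem_scheme \<Rightarrow> ('m \<Rightarrow> real) set" where
  "densities M = {c. smooth_fun M c \<and> (\<forall>p. 0 \<le> c p) \<and> (LINT p|vol M. c p) = 1}"

text \<open>The tangent space of the densities, which is the same at all of them.\<close>

definition tangents :: "('m, 'n::finite, 'z) riem_scheme \<Rightarrow> ('m \<Rightarrow> real) set" where
  "tangents M = {h. smooth_fun M h \<and> (LINT p|vol M. h p) = 0}"

definition transport ::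
    "('m, 'n::finite, 'z) riem_scheme \<Rightarrow> ('m \<Rightarrow> real) \<Rightarrow> ('m \<Rightarrow> real^'n) \<Rightarrow> 'm \<Rightarrow> real" where
  "transport M c w = (\<lambda>p. - dvg M (\<lambda>q. c q *\<^sub>R w q) p)"

definition neumann_solution ::
    "('m, 'n::finite, 'z) riem_scheme \<Rightarrow> ('m \<Rightarrow> real) \<Rightarrow> ('m \<Rightarrow> real) \<Rightarrow> ('m \<Rightarrow> real) \<Rightarrow> bool" where
  "neumann_solution M c h C \<longleftrightarrow> smooth_fun M C \<and>
     (\<forall>p. - dvg M (\<lambda>q. c q *\<^sub>R grad M C q) p = h p) \<and>
     (\<forall>p\<in>boundary M. metric M p (grad M C p) (normal M p) = 0)"

definition wasserstein ::
    "('m, 'n::finite, 'z) riem_scheme \<Rightarrow> ('m \<Rightarrow> real) \<Rightarrow> ('m \<Rightarrow> real) \<Rightarrow> ('m \<Rightarrow> real) \<Rightarrow> real" where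
  "wasserstein M c h1 h2 = (THE r. \<exists>C1 C2. neumann_solution M c h1 C1 \<and> neumann_solution M c h2 C2 \<and>
     r = (LINT p|vol M. c p * metric M p (grad M C1 p) (grad M C2 p)))"


section \<open>Differential and gradients of a free energy\<close>

text \<open>Only the values of \<open>F\<close> on the densities matter. The differential at \<open>c\<close> is a linear
  functional giving the directional derivative of \<open>F\<close> at \<open>c\<close>; where \<open>c\<close> has zeros, the line
  \<open>c + s h\<close> may stay in the densities for \<open>s\<close> on one side of \<open>0\<close> only, or not at all. On a compact
  manifold the functional is still unique on \<open>tangents M\<close>: the directions \<open>f - (\<integral>f dV) c\<close> with
  smooth \<open>f \<ge> 0\<close> are admissible for small \<open>s \<ge> 0\<close>, and they span \<open>tangents M\<close>.\<close>

definition is_differential ::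
    "('m, 'n::finite, 'z) riem_scheme \<Rightarrow> (('m \<Rightarrow> real) \<Rightarrow> real) \<Rightarrow> ('m \<Rightarrow> real) \<Rightarrow>
     (('m \<Rightarrow> real) \<Rightarrow> real) \<Rightarrow> bool" where
  "is_differential M F c L \<longleftrightarrow>
     (\<forall>h1\<in>tangents M. \<forall>h2\<in>tangents M. \<forall>r s. L (\<lambda>p. r * h1 p + s * h2 p) = r * L h1 + s * L h2) \<and>
     (\<forall>h\<in>tangents M. ((\<lambda>s. F (\<lambda>p. c p + s * h p)) has_real_derivative L h)
        (at 0 within {s. (\<lambda>p. c p + s * h p) \<in> densities M}))"

definition energy_differentiable ::
    "('m, 'n::finite, 'z) riem_scheme \<Rightarrow> (('m \<Rightarrow> real) \<Rightarrow> real) \<Rightarrow> ('m \<Rightarrow> real) \<Rightarrow> bool" where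
  "energy_differentiable M F c \<longleftrightarrow> (\<exists>L. is_differential M F c L)"

definition dF ::
    "('m, 'n::finite, 'z) riem_scheme \<Rightarrow> (('m \<Rightarrow> real) \<Rightarrow> real) \<Rightarrow> ('m \<Rightarrow> real) \<Rightarrow>
     ('m \<Rightarrow> real) \<Rightarrow> real" where
  "dF M F c = (SOME L. is_differential M F c L)"

definition is_grad_L2 ::
    "('m, 'n::finite, 'z) riem_scheme \<Rightarrow> (('m \<Rightarrow> real) \<Rightarrow> real) \<Rightarrow> ('m \<Rightarrow> real) \<Rightarrow>
     ('m \<Rightarrow> real) \<Rightarrow> bool" where
  "is_grad_L2 M F c G \<longleftrightarrow> smooth_fun M G \<and>
     (\<forall>h\<in>tangents M. dF M F c h = (LINT p|vol M. G p * h p))"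

definition is_grad_W ::
    "('m, 'n::finite, 'z) riem_scheme \<Rightarrow> (('m \<Rightarrow> real) \<Rightarrow> real) \<Rightarrow> ('m \<Rightarrow> real) \<Rightarrow>
     ('m \<Rightarrow> real) \<Rightarrow> bool" where
  "is_grad_W M F c G \<longleftrightarrow> G \<in> tangents M \<and> (\<forall>h\<in>tangents M. dF M F c h = wasserstein M c G h)"


section \<open>Onsager's variational principle\<close>

definition rayleighian ::
    "('c \<Rightarrow> 'd \<Rightarrow> real) \<Rightarrow> ('c \<Rightarrow> 'w \<Rightarrow> real) \<Rightarrow> ('c \<Rightarrow> 'w \<Rightarrow> 'd) \<Rightarrow> 'c \<Rightarrow> 'w \<Rightarrow> real" where
  "rayleighian dE D P c w = dE c (P c w) + D c w"

text \<open>A curve \<open>c\<close> in the set \<open>Q\<close> of functions, defined for times in \<open>T\<close> and with time derivative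
  \<open>c'\<close>. The time derivative is taken pointwise, which is the weakest sense.\<close>

definition ovp_solution ::
    "('m \<Rightarrow> real) set \<Rightarrow> (('m \<Rightarrow> real) \<Rightarrow> ('m \<Rightarrow> real) \<Rightarrow> real) \<Rightarrow> (('m \<Rightarrow> real) \<Rightarrow> 'w set) \<Rightarrow>
     (('m \<Rightarrow> real) \<Rightarrow> 'w \<Rightarrow> real) \<Rightarrow> (('m \<Rightarrow> real) \<Rightarrow> 'w \<Rightarrow> ('m \<Rightarrow> real)) \<Rightarrow>
     real set \<Rightarrow> (real \<Rightarrow> 'm \<Rightarrow> real) \<Rightarrow> (real \<Rightarrow> 'm \<Rightarrow> real) \<Rightarrow> bool" where
  "ovp_solution Q dE E D P T c c' \<longleftrightarrow> (\<forall>t\<in>T. c t \<in> Q \<and>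
     (\<forall>p. ((\<lambda>s. c s p) has_real_derivative c' t p) (at t within T)) \<and>
     (\<exists>v. is_arg_min (rayleighian dE D P (c t)) (\<lambda>w. w \<in> E (c t)) v \<and> c' t = P (c t) v))"

definition tangential_fields :: "('m, 'n::finite, 'z) riem_scheme \<Rightarrow> ('m \<Rightarrow> real^'n) set" where
  "tangential_fields M =
     {w. smooth_field M w \<and> (\<forall>p\<in>boundary M. metric M p (w p) (normal M p) = 0)}"

definition dissipation ::
    "('m, 'n::finite, 'z) riem_scheme \<Rightarrow> ('m \<Rightarrow> real) \<Rightarrow> ('m \<Rightarrow> real^'n) \<Rightarrow> real" where
  "dissipation M c w = 1 / 2 * (LINT p|vol M. c p * metric M p (w p) (w p))"

end

theory Submission
  imports Defs
begin

text \<open>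
  Fix a time and write \<open>c\<close> for the density, \<open>H\<close> for the Wasserstein gradient and \<open>C\<close> for a Neumann
  solution with \<open>- div (c \<nabla>C) = H\<close>. Everything follows from integration by parts for tangential
  fields \<open>w\<close>: \<open>\<integral> f (- div (c w)) dV = \<integral> c g(\<nabla>f, w) dV\<close>. It shows that \<open>- div (c w)\<close> is a tangent vector
  of the densities, that the Wasserstein product is well defined with \<open>W(H, h) = \<integral> C h dV\<close>, and hence that
  \<open>C\<close> represents the differential of the energy in the \<open>L\<^sup>2\<close> sense.

  The Rayleighian is therefore \<open>\<integral> c g(\<nabla>C, w) dV + (1/2) \<integral> c g(w, w) dV\<close>. Since \<open>\<nabla>C\<close> is itself tangential,
  completing the square against the competitor \<open>-\<nabla>C\<close> gives \<open>c v = - c \<nabla>C\<close> for every minimizer \<open>v\<close>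
  (\<open>rayleighian_minimizer\<close>), so that \<open>\<partial>\<^sub>t c = - div (c v) = div (c \<nabla>C) = - H\<close>. Where \<open>c\<close> vanishes nothing is
  said about \<open>v\<close>, but only \<open>c v\<close> enters. Finally \<open>C\<close> and the \<open>L\<^sup>2\<close> gradient represent the same functional
  on the functions of mean zero, so they differ by a constant
  (\<open>orthogonal_tangents_constant\<close>) and have the same gradient; in particular the latter inherits
  the Neumann condition.

  Integration by parts (\<open>integration_by_parts\<close>) is built from the definitions. In the half-space,
  \<open>\<integral> \<partial>\<^sub>i Y = 0\<close> is the limit of the integrals of difference quotients, which vanish by translation invariance
  of Lebesgue measure (\<open>half_space_integral_pd\<close>). A chart turns this into the theorem for functions
  supported in the chart, with the divergence computed in that chart
  (\<open>chart_integration_by_parts\<close>). Testing with bump functions then shows that the divergences computed in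
  two charts agree (\<open>coord_div_le\<close>), because one and the same volume measure has the right density in every
  chart. A partition of unity globalizes. The bumps are only of class \<open>C\<^sup>1\<close>, of the elementary form
  \<open>(max 0 (r\<^sup>2 - |x - y|\<^sup>2))\<^sup>2\<close>.
\<close>

section \<open>Differentiation inside the half-space\<close>

text \<open>The coordinate domains are relatively open in the half-space, and there the derivative within the
  domain is the derivative within the half-space. Using the latter throughout removes the domain from
  the notation.\<close>
abbreviation hopen :: "(real^'n::finite) set \<Rightarrow> bool" where
  "hopen \<equiv> openin (top_of_set half_space)"

abbreviation hderiv :: "(real^'n::finite \<Rightarrow> 'b::real_normed_vector) \<Rightarrow> real^'n \<Rightarrow> real^'n \<Rightarrow> 'b" where
  "hderiv f x \<equiv> frechet_derivative f (at x within half_space)"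

definition pd :: "'n::finite \<Rightarrow> (real^'n \<Rightarrow> 'b::real_normed_vector) \<Rightarrow> real^'n \<Rightarrow> 'b" where
  "pd i f x = hderiv f x (axis i 1)"

lemma closed_half_space: "closed (half_space :: (real^'n::finite) set)"
  unfolding half_space_def by (intro closed_Collect_le continuous_intros)

lemma convex_half_space: "convex (half_space :: (real^'n::finite) set)"
  by (auto simp: half_space_def convex_def)

lemma hopen_subset: "hopen U \<Longrightarrow> U \<subseteq> half_space"
  by (simp add: openin_imp_subset)

lemma hopen_borel: "hopen U \<Longrightarrow> U \<in> sets borel"
  using closed_half_space
  by (metis borel_closed borel_open openin_open sets.Int)

lemma hopen_at_within:
  assumes "hopen U" "x \<in> U"
  shows "at x within U = at x within half_space"
proof -
  obtain O' where "open O'" "U = half_space \<inter> O'" using assms(1) by (auto simp: openin_open)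
  then show ?thesis using assms by (intro at_within_nhd[of x O']) auto
qed

lemma hopen_ball:
  assumes "hopen U" "x \<in> U"
  obtains r where "r > 0" "cball x r \<inter> half_space \<subseteq> U"
proof -
  obtain O' where O: "open O'" "U = half_space \<inter> O'" using assms(1) by (auto simp: openin_open)
  then obtain r where "r > 0" "cball x r \<subseteq> O'"
    using assms(2) by (metis IntD2 open_contains_cball)
  then show ?thesis using O by (intro that[of r]) auto
qed

lemma half_space_add:
  "x \<in> half_space \<Longrightarrow> 0 \<le> d \<Longrightarrow> x + d *\<^sub>R axis i 1 \<in> (half_space :: (real^'n::finite) set)"
  by (auto simp: half_space_def axis_def)

text \<open>Each coordinate direction is admissible from every point of the half-space for positive increments,
  which is enough to determine a linear map.\<close>
lemma hderiv_unique:
  fixes f :: "real^'n::finite \<Rightarrow> 'b::real_normed_vector"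
  assumes "(f has_derivative f') (at x within half_space)" "x \<in> half_space"
  shows "hderiv f x = f'"
proof (rule frechet_derivative_unique_within)
  show "(f has_derivative hderiv f x) (at x within half_space)"
    using assms(1) frechet_derivative_works differentiableI by blast
  fix i :: "real^'n" and e :: real
  assume "i \<in> Basis" "e > 0"
  then obtain k where "i = axis k 1" by (auto simp: Basis_vec_def)
  with \<open>e > 0\<close> assms(2) show "\<exists>d. 0 < \<bar>d\<bar> \<and> \<bar>d\<bar> < e \<and> x + d *\<^sub>R i \<in> half_space"
    by (intro exI[of _ "e/2"]) (auto intro: half_space_add)
qed (rule assms)

lemma pd_eq:
  assumes "(f has_derivative f') (at x within half_space)" "x \<in> half_space"
  shows "pd i f x = f' (axis i 1)"
  unfolding pd_def using hderiv_unique[OF assms] by simp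

lemma has_hderiv_cong:
  assumes "hopen U" "x \<in> U" "\<And>y. y \<in> U \<Longrightarrow> f y = g y"
  shows "(f has_derivative D) (at x within half_space) \<longleftrightarrow> (g has_derivative D) (at x within half_space)"
  unfolding hopen_at_within[OF assms(1,2), symmetric]
  using assms(2,3) by (metis has_derivative_transform)

lemma hderiv_cong:
  assumes "hopen U" "x \<in> U" "\<And>y. y \<in> U \<Longrightarrow> f y = g y"
  shows "hderiv f x = hderiv g x"
  using has_hderiv_cong[OF assms] by (simp add: frechet_derivative_def)

lemma pd_cong:
  assumes "hopen U" "x \<in> U" "\<And>y. y \<in> U \<Longrightarrow> f y = g y"
  shows "pd i f x = pd i g x"
  unfolding pd_def using hderiv_cong[OF assms] by simp

text \<open>The recursion of \<open>ck_on\<close> with partial derivatives that do not mention the domain; the proofs below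
  use it in place of the defining equation.\<close>
lemma ck_on_Suc:
  fixes f :: "real^'n::finite \<Rightarrow> 'b::real_normed_vector"
  assumes "hopen U"
  shows "ck_on (Suc k) U f \<longleftrightarrow>
    (\<forall>x\<in>U. f differentiable (at x within half_space)) \<and> (\<forall>i. ck_on k U (pd i f))"
proof -
  have cong: "ck_on k U g \<longleftrightarrow> ck_on k U h" if "\<And>x. x \<in> U \<Longrightarrow> g x = h x"
    for k and g h :: "real^'n \<Rightarrow> 'b"
    using that
  proof (induction k arbitrary: g h)
    case 0 then show ?case by (simp cong: continuous_on_cong)
  next
    case (Suc k)
    have d: "(g has_derivative D) (at x within U) \<longleftrightarrow> (h has_derivative D) (at x within U)"
      if "x \<in> U" for D x
      using Suc.prems that by (metis has_derivative_transform)
    have "ck_on k U (\<lambda>x. frechet_derivative g (at x within U) e) \<longleftrightarrow>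
          ck_on k U (\<lambda>x. frechet_derivative h (at x within U) e)" for e
      by (rule Suc.IH) (simp add: frechet_derivative_def d)
    then show ?case using d by (simp add: differentiable_on_def differentiable_def)
  qed
  have "ck_on k U (\<lambda>x. frechet_derivative f (at x within U) (axis i 1)) \<longleftrightarrow> ck_on k U (pd i f)" for i
    by (rule cong) (simp add: pd_def hopen_at_within[OF assms])
  moreover have "(\<forall>e\<in>(Basis :: (real^'n) set). P e) \<longleftrightarrow> (\<forall>i. P (axis i 1))" for P
    by (auto simp: Basis_vec_def)
  ultimately show ?thesis
    using hopen_at_within[OF assms] by (auto simp: differentiable_on_def)
qed

lemma ck_on_cong:
  fixes f g :: "real^'n::finite \<Rightarrow> 'b::real_normed_vector"
  assumes "hopen U" "\<And>x. x \<in> U \<Longrightarrow> f x = g x"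
  shows "ck_on k U f \<longleftrightarrow> ck_on k U g"
  using assms(2)
proof (induction k arbitrary: f g)
  case 0 then show ?case by (simp cong: continuous_on_cong)
next
  case (Suc k)
  have "ck_on k U (pd i f) \<longleftrightarrow> ck_on k U (pd i g)" for i
    using Suc.prems by (intro Suc.IH pd_cong[OF assms(1)])
  then show ?case
    using has_hderiv_cong[OF assms(1) _ Suc.prems]
    by (auto simp: ck_on_Suc[OF assms(1)] differentiable_def simp del: ck_on.simps)
qed

lemma ck_on_SucI:
  fixes f :: "real^'n::finite \<Rightarrow> 'b::real_normed_vector"
  assumes "hopen U" "\<And>x. x \<in> U \<Longrightarrow> (f has_derivative D x) (at x within half_space)"
    "\<And>i. ck_on k U (\<lambda>x. D x (axis i 1))"
  shows "ck_on (Suc k) U f"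
proof -
  have "ck_on k U (pd i f) \<longleftrightarrow> ck_on k U (\<lambda>x. D x (axis i 1))" for i
    using assms(2) hopen_subset[OF assms(1)] by (intro ck_on_cong[OF assms(1)] pd_eq) auto
  then show ?thesis using assms by (auto simp: ck_on_Suc differentiable_def simp del: ck_on.simps)
qed

lemma ck_on_deriv:
  fixes f :: "real^'n::finite \<Rightarrow> 'b::real_normed_vector"
  assumes "hopen U" "ck_on (Suc k) U f" "x \<in> U"
  shows "(f has_derivative hderiv f x) (at x within half_space)"
  using assms by (auto simp: ck_on_Suc frechet_derivative_works simp del: ck_on.simps)

lemma ck_on_pd:
  fixes f :: "real^'n::finite \<Rightarrow> 'b::real_normed_vector"
  assumes "hopen U" "ck_on (Suc k) U f"
  shows "ck_on k U (pd i f)"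
  using assms by (auto simp: ck_on_Suc simp del: ck_on.simps)

lemma ck_on_imp_continuous_on: "ck_on k U f \<Longrightarrow> continuous_on U f"
  by (cases k) (simp_all, blast intro: differentiable_imp_continuous_on)

lemma ck_on_decr:
  fixes f :: "real^'n::finite \<Rightarrow> 'b::real_normed_vector"
  assumes "hopen U" "ck_on (Suc k) U f"
  shows "ck_on k U f"
  using assms(2)
proof (induction k arbitrary: f)
  case 0 then show ?case by (metis ck_on.simps(1) ck_on_imp_continuous_on)
next
  case (Suc k)
  then show ?case using ck_on_Suc[OF assms(1)] by blast
qed

text \<open>Being \<open>C\<^sup>k\<close> is a local property; functions defined by cases on open pieces are handled with it.\<close>
lemma ck_on_local:
  fixes f :: "real^'n::finite \<Rightarrow> 'b::real_normed_vector"
  assumes "hopen U" "\<And>x. x \<in> U \<Longrightarrow> \<exists>V. hopen V \<and> x \<in> V \<and> V \<subseteq> U \<and> ck_on k V f"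
  shows "ck_on k U f"
  using assms(2)
proof (induction k arbitrary: f)
  case 0
  have "continuous (at x within U) f" if x: "x \<in> U" for x
  proof -
    obtain V where V: "hopen V" "x \<in> V" "continuous_on V f" using 0 x by force
    then show ?thesis
      by (metis assms(1) continuous_on_eq_continuous_within hopen_at_within x)
  qed
  then show ?case by (simp add: continuous_on_eq_continuous_within)
next
  case (Suc k)
  have *: "f differentiable (at x within half_space)
           \<and> (\<forall>i. \<exists>V. hopen V \<and> x \<in> V \<and> V \<subseteq> U \<and> ck_on k V (pd i f))" if x: "x \<in> U" for x
  proof -
    obtain V where V: "hopen V" "x \<in> V" "V \<subseteq> U" "ck_on (Suc k) V f" using Suc.prems x by blast
    then show ?thesis unfolding ck_on_Suc[OF V(1)] by blast
  qed
  then show ?case unfolding ck_on_Suc[OF assms(1)] using Suc.IH by blast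
qed

lemma hderiv_linear:
  fixes f :: "real^'n::finite \<Rightarrow> 'b::real_normed_vector"
  assumes "(f has_derivative hderiv f x) (at x within half_space)"
  shows "hderiv f x u = (\<Sum>i\<in>UNIV. (u $ i) *\<^sub>R pd i f x)"
proof -
  have l: "linear (hderiv f x)" using assms by (simp add: has_derivative_linear)
  have "u = (\<Sum>i\<in>UNIV. (u $ i) *\<^sub>R axis i 1)"
    by (metis (no_types, lifting) basis_expansion scalar_mult_eq_scaleR sum.cong)
  then have "hderiv f x u = hderiv f x (\<Sum>i\<in>UNIV. (u $ i) *\<^sub>R axis i 1)" by simp
  also have "\<dots> = (\<Sum>i\<in>UNIV. (u $ i) *\<^sub>R hderiv f x (axis i 1))"
    by (simp add: linear_sum[OF l] linear_scale[OF l])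
  finally show ?thesis by (simp add: pd_def)
qed

subsection \<open>Algebraic operations on \<open>C\<^sup>k\<close> functions\<close>

lemma ck_on_const: "hopen U \<Longrightarrow> ck_on k U (\<lambda>x. c)"
proof (induction k arbitrary: c)
  case (Suc k)
  then show ?case by (intro ck_on_SucI[where D = "\<lambda>x h. 0"]) auto
qed simp

lemma ck_on_add:
  fixes f g :: "real^'n::finite \<Rightarrow> 'b::real_normed_vector"
  assumes "hopen U"
  shows "ck_on k U f \<Longrightarrow> ck_on k U g \<Longrightarrow> ck_on k U (\<lambda>x. f x + g x)"
proof (induction k arbitrary: f g)
  case 0 then show ?case by (simp add: continuous_on_add)
next
  case (Suc k)
  show ?case
  proof (rule ck_on_SucI[OF assms, where D = "\<lambda>x h. hderiv f x h + hderiv g x h"])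
    show "((\<lambda>x. f x + g x) has_derivative (\<lambda>h. hderiv f x h + hderiv g x h)) (at x within half_space)"
      if "x \<in> U" for x
      by (intro has_derivative_add ck_on_deriv[OF assms Suc.prems(1) that]
          ck_on_deriv[OF assms Suc.prems(2) that])
    show "ck_on k U (\<lambda>x. hderiv f x (axis i 1) + hderiv g x (axis i 1))" for i
      using Suc.IH[OF ck_on_pd[OF assms Suc.prems(1)] ck_on_pd[OF assms Suc.prems(2)]]
      by (simp add: pd_def)
  qed
qed

lemma ck_on_mult:
  fixes f g :: "real^'n::finite \<Rightarrow> real"
  assumes "hopen U"
  shows "ck_on k U f \<Longrightarrow> ck_on k U g \<Longrightarrow> ck_on k U (\<lambda>x. f x * g x)"
proof (induction k arbitrary: f g)
  case 0 then show ?case by (simp add: continuous_on_mult)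
next
  case (Suc k)
  show ?case
  proof (rule ck_on_SucI[OF assms, where D = "\<lambda>x h. f x * hderiv g x h + hderiv f x h * g x"])
    show "((\<lambda>x. f x * g x) has_derivative (\<lambda>h. f x * hderiv g x h + hderiv f x h * g x))
        (at x within half_space)" if "x \<in> U" for x
      by (intro has_derivative_mult ck_on_deriv[OF assms Suc.prems(1) that]
          ck_on_deriv[OF assms Suc.prems(2) that])
    show "ck_on k U (\<lambda>x. f x * hderiv g x (axis i 1) + hderiv f x (axis i 1) * g x)" for i
      using Suc.IH[OF ck_on_decr[OF assms Suc.prems(1)] ck_on_pd[OF assms Suc.prems(2), of i]]
        Suc.IH[OF ck_on_pd[OF assms Suc.prems(1), of i] ck_on_decr[OF assms Suc.prems(2)]]
      unfolding pd_def by (intro ck_on_add[OF assms])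
  qed
qed

lemma ck_on_minus:
  fixes f :: "real^'n::finite \<Rightarrow> real"
  assumes "hopen U" "ck_on k U f"
  shows "ck_on k U (\<lambda>x. - f x)"
  using ck_on_mult[OF assms(1) ck_on_const[OF assms(1), where c = "-1"] assms(2)] by simp

lemma ck_on_sum:
  fixes f :: "'i \<Rightarrow> real^'n::finite \<Rightarrow> real"
  assumes "hopen U" "\<And>i. i \<in> I \<Longrightarrow> ck_on k U (f i)"
  shows "ck_on k U (\<lambda>x. \<Sum>i\<in>I. f i x)"
  using assms(2)
  by (induction I rule: infinite_finite_induct) (auto intro: ck_on_add ck_on_const assms(1))

lemma ck_on_prod:
  fixes f :: "'i \<Rightarrow> real^'n::finite \<Rightarrow> real"
  assumes "hopen U" "\<And>i. i \<in> I \<Longrightarrow> ck_on k U (f i)"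
  shows "ck_on k U (\<lambda>x. \<Prod>i\<in>I. f i x)"
  using assms(2)
  by (induction I rule: infinite_finite_induct) (auto intro: ck_on_mult ck_on_const assms(1))

text \<open>The derivative of \<open>1/f\<close> is a product of \<open>1/f\<close>, again \<open>1/f\<close> and a derivative of \<open>f\<close>, so the induction
  hypothesis applies to it. The square root is treated alike.\<close>
lemma ck_on_inverse:
  fixes f :: "real^'n::finite \<Rightarrow> real"
  assumes U: "hopen U" and f0: "\<And>x. x \<in> U \<Longrightarrow> f x \<noteq> 0"
  shows "ck_on k U f \<Longrightarrow> ck_on k U (\<lambda>x. inverse (f x))"
proof (induction k)
  case 0 then show ?case using f0 by (simp add: continuous_on_inverse)
next
  case (Suc k)
  have inv: "ck_on k U (\<lambda>x. inverse (f x))" using Suc ck_on_decr[OF U] by blast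
  show ?case
  proof (rule ck_on_SucI[OF U, where D = "\<lambda>x h. - (inverse (f x) * hderiv f x h * inverse (f x))"])
    show "((\<lambda>x. inverse (f x)) has_derivative (\<lambda>h. - (inverse (f x) * hderiv f x h * inverse (f x))))
        (at x within half_space)" if "x \<in> U" for x
      by (rule Deriv.has_derivative_inverse[OF f0[OF that] ck_on_deriv[OF U Suc.prems that]])
    show "ck_on k U (\<lambda>x. - (inverse (f x) * hderiv f x (axis i 1) * inverse (f x)))" for i
      using ck_on_pd[OF U Suc.prems, of i] inv unfolding pd_def
      by (intro ck_on_minus ck_on_mult U)
  qed
qed

lemma ck_on_sqrt:
  fixes f :: "real^'n::finite \<Rightarrow> real"
  assumes U: "hopen U" and f0: "\<And>x. x \<in> U \<Longrightarrow> 0 < f x"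
  shows "ck_on k U f \<Longrightarrow> ck_on k U (\<lambda>x. sqrt (f x))"
proof (induction k)
  case 0 then show ?case by (simp add: continuous_on_real_sqrt)
next
  case (Suc k)
  have s: "ck_on k U (\<lambda>x. sqrt (f x))" using Suc ck_on_decr[OF U] by blast
  show ?case
  proof (rule ck_on_SucI[OF U, where D = "\<lambda>x h. hderiv f x h * (inverse (sqrt (f x)) * (1/2))"])
    show "((\<lambda>x. sqrt (f x)) has_derivative (\<lambda>h. hderiv f x h * (inverse (sqrt (f x)) * (1/2))))
        (at x within half_space)" if "x \<in> U" for x
    proof (rule DERIV_compose_FDERIV[OF _ ck_on_deriv[OF U Suc.prems that]])
      show "(sqrt has_real_derivative inverse (sqrt (f x)) * (1/2)) (at (f x))"
        using DERIV_real_sqrt[OF f0[OF that]] by simp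
    qed
    show "ck_on k U (\<lambda>x. hderiv f x (axis i 1) * (inverse (sqrt (f x)) * (1/2)))" for i
      using ck_on_pd[OF U Suc.prems, of i] s f0 unfolding pd_def
      by (intro ck_on_mult U ck_on_const ck_on_inverse) force+
  qed
qed

lemma ck_on_det:
  fixes A :: "real^'n::finite \<Rightarrow> real^'m::finite^'m"
  assumes "hopen U" "\<And>i j. ck_on k U (\<lambda>x. A x $ i $ j)"
  shows "ck_on k U (\<lambda>x. det (A x))"
  unfolding det_def by (intro ck_on_sum ck_on_mult ck_on_prod ck_on_const assms)

lemma ck_on_component:
  fixes f :: "real^'n::finite \<Rightarrow> real^'m::finite"
  assumes "hopen U"
  shows "ck_on k U f \<longleftrightarrow> (\<forall>j. ck_on k U (\<lambda>x. f x $ j))"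
proof (induction k arbitrary: f)
  case 0
  have "continuous_on U f" if "\<And>j. continuous_on U (\<lambda>x. f x $ j)"
    using continuous_on_vec_lambda[of U "\<lambda>j x. f x $ j"] that by simp
  then show ?case by (auto intro: continuous_intros)
next
  case (Suc k)
  have d: "(f has_derivative D) (at x within S) \<longleftrightarrow> (\<forall>j. ((\<lambda>x. f x $ j) has_derivative (\<lambda>h. D h $ j)) (at x within S))"
    for D x S
    by (subst has_derivative_componentwise_within)
       (auto simp: Basis_vec_def inner_axis)
  have diff: "f differentiable (at x within S) \<longleftrightarrow>
      (\<forall>j. (\<lambda>x. f x $ j) differentiable (at x within S))" for x S
  proof
    assume "\<forall>j. (\<lambda>x. f x $ j) differentiable (at x within S)"
    then obtain D where "\<And>j. ((\<lambda>x. f x $ j) has_derivative D j) (at x within S)"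
      unfolding differentiable_def by metis
    then have "(f has_derivative (\<lambda>h. \<chi> j. D j h)) (at x within S)" by (simp add: d)
    then show "f differentiable (at x within S)" by (auto simp: differentiable_def)
  qed (use d in \<open>auto simp: differentiable_def\<close>)
  have "ck_on k U (\<lambda>x. pd i f x $ j) \<longleftrightarrow> ck_on k U (pd i (\<lambda>x. f x $ j))"
    if "\<forall>x\<in>U. f differentiable (at x within half_space)" for i j
  proof (rule ck_on_cong[OF assms])
    fix x assume x: "x \<in> U"
    have "(f has_derivative hderiv f x) (at x within half_space)"
      using that x by (simp add: frechet_derivative_works)
    then show "pd i f x $ j = pd i (\<lambda>x. f x $ j) x"
      using pd_eq[of "\<lambda>x. f x $ j" "\<lambda>h. hderiv f x h $ j" x i] d hopen_subset[OF assms] x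
      by (auto simp: pd_def)
  qed
  then show ?case using diff by (auto simp: ck_on_Suc[OF assms] Suc simp del: ck_on.simps)
qed

section \<open>The divergence theorem in the half-space\<close>

lemma norm_hderiv_le:
  fixes f :: "real^'n::finite \<Rightarrow> real"
  assumes "(f has_derivative hderiv f x) (at x within half_space)"
  shows "onorm (hderiv f x) \<le> (\<Sum>j\<in>UNIV. \<bar>pd j f x\<bar>)"
proof (rule onorm_bound)
  fix u :: "real^'n"
  have "norm (hderiv f x u) \<le> (\<Sum>j\<in>UNIV. \<bar>u $ j\<bar> * \<bar>pd j f x\<bar>)"
    unfolding hderiv_linear[OF assms] real_norm_def real_scaleR_def abs_mult[symmetric]
    by (rule sum_abs)
  also have "\<dots> \<le> (\<Sum>j\<in>UNIV. norm u * \<bar>pd j f x\<bar>)"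
    by (intro sum_mono mult_right_mono) (auto simp: component_le_norm_cart)
  finally show "norm (hderiv f x u) \<le> (\<Sum>j\<in>UNIV. \<bar>pd j f x\<bar>) * norm u"
    by (simp add: sum_distrib_left mult.commute)
qed (auto intro: sum_nonneg)

lemma ck_on_extend_zero:
  fixes f :: "real^'n::finite \<Rightarrow> real"
  assumes U: "hopen U" and K: "closed K" "K \<subseteq> U" and f: "ck_on k U f"
    and off: "\<And>x. x \<in> U \<Longrightarrow> x \<notin> K \<Longrightarrow> f x = 0"
  shows "ck_on k half_space (\<lambda>x. if x \<in> K then f x else 0)"
proof (rule ck_on_local)
  fix x :: "real^'n" assume x: "x \<in> half_space"
  have V: "hopen (half_space - K)"
    using K by (auto simp: openin_open intro!: exI[of _ "- K"])
  show "\<exists>V. hopen V \<and> x \<in> V \<and> V \<subseteq> half_space \<and> ck_on k V (\<lambda>x. if x \<in> K then f x else 0)"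
  proof (cases "x \<in> K")
    case True
    have "ck_on k U (\<lambda>x. if x \<in> K then f x else 0) \<longleftrightarrow> ck_on k U f"
      using off by (intro ck_on_cong[OF U]) auto
    then show ?thesis using True K U f hopen_subset by blast
  next
    case False
    have "ck_on k (half_space - K) (\<lambda>x. if x \<in> K then f x else 0) \<longleftrightarrow> ck_on k (half_space - K) (\<lambda>x. 0 :: real)"
      by (intro ck_on_cong[OF V]) auto
    then show ?thesis using False V x ck_on_const[OF V] by blast
  qed
qed simp

text \<open>A \<open>C\<^sup>1\<close> function with compact support has bounded derivative, and the half-space is convex.\<close>
lemma half_space_lipschitz:
  fixes Z :: "real^'n::finite \<Rightarrow> real"
  assumes Z: "ck_on (Suc 0) half_space Z" and K: "compact K" "K \<subseteq> half_space"
    and off: "\<And>x. x \<in> half_space \<Longrightarrow> x \<notin> K \<Longrightarrow> Z x = 0"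
  obtains B where "B \<ge> 0" "\<And>x y. x \<in> half_space \<Longrightarrow> y \<in> half_space \<Longrightarrow> \<bar>Z x - Z y\<bar> \<le> B * norm (x - y)"
proof -
  have H: "hopen (half_space :: (real^'n) set)" by simp
  have V: "hopen (half_space - K)"
    using K by (auto simp: openin_open compact_imp_closed intro!: exI[of _ "- K"])
  have "continuous_on K (\<lambda>x. \<Sum>j\<in>UNIV. \<bar>pd j Z x\<bar>)"
    using ck_on_pd[OF H Z] K(2) by (intro continuous_intros) (auto intro: continuous_on_subset)
  then have "compact ((\<lambda>x. \<Sum>j\<in>UNIV. \<bar>pd j Z x\<bar>) ` K)" using K(1) compact_continuous_image by blast
  then obtain B where B: "B > 0" "\<And>y. y \<in> (\<lambda>x. \<Sum>j\<in>UNIV. \<bar>pd j Z x\<bar>) ` K \<Longrightarrow> norm y \<le> B"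
    using bounded_pos compact_imp_bounded by metis
  have B': "(\<Sum>j\<in>UNIV. \<bar>pd j Z x\<bar>) \<le> B" if "x \<in> K" for x
    using B(2)[OF imageI[OF that]] by simp
  have on: "onorm (hderiv Z x) \<le> B" if x: "x \<in> half_space" for x
  proof (cases "x \<in> K")
    case True then show ?thesis
      using order_trans[OF norm_hderiv_le[OF ck_on_deriv[OF H Z x]] B'[OF True]] by simp
  next
    case False
    have "((\<lambda>x. 0) has_derivative (\<lambda>x. 0)) (at x within half_space)" by simp
    then have "(Z has_derivative (\<lambda>x. 0)) (at x within half_space)"
      using has_hderiv_cong[OF V, of x Z "\<lambda>x. 0"] False x off by auto
    then have "hderiv Z x = (\<lambda>x. 0)" using hderiv_unique x by blast
    then show ?thesis using B by (simp add: onorm_zero)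
  qed
  have "norm (Z x - Z y) \<le> B * norm (x - y)" if "x \<in> half_space" "y \<in> half_space" for x y
    by (rule differentiable_bound[OF convex_half_space _ on]) (use ck_on_deriv[OF H Z] that in auto)
  then show ?thesis using B(1) by (intro that[of B]) auto
qed

lemma hderiv_quotient:
  fixes Z :: "real^'n::finite \<Rightarrow> real"
  assumes "(Z has_derivative hderiv Z x) (at x within half_space)" "x \<in> half_space"
  shows "(\<lambda>m. (Z (x + inverse (real (Suc m)) *\<^sub>R axis i 1) - Z x) * real (Suc m)) \<longlonglongrightarrow> pd i Z x"
proof -
  have lin: "linear (hderiv Z x)" using assms(1) by (simp add: has_derivative_linear)
  have "((\<lambda>s. x + s *\<^sub>R axis i 1) has_derivative (\<lambda>s. s *\<^sub>R axis i 1)) (at (0::real) within {0..})"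
    by (auto intro!: derivative_eq_intros)
  moreover have "(Z has_derivative hderiv Z x)
      (at (x + (0::real) *\<^sub>R axis i 1) within (\<lambda>s. x + s *\<^sub>R axis i 1) ` {0::real..})"
    using assms by (auto intro: has_derivative_subset half_space_add)
  ultimately have "((\<lambda>s. Z (x + s *\<^sub>R axis i 1)) has_derivative (\<lambda>s. hderiv Z x (s *\<^sub>R axis i 1)))
     (at (0::real) within {0..})"
    by (rule has_derivative_in_compose)
  then have "((\<lambda>s. Z (x + s *\<^sub>R axis i 1)) has_real_derivative pd i Z x) (at 0 within {0..})"
    by (simp add: has_field_derivative_def pd_def linear_scale[OF lin] mult.commute[of _ "hderiv Z x _"])
  then have lim: "((\<lambda>s. (Z (x + s *\<^sub>R axis i 1) - Z x) / s) \<longlongrightarrow> pd i Z x) (at 0 within {0..})"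
    by (simp add: has_field_derivative_iff)
  have "filterlim (\<lambda>m. inverse (real (Suc m))) (at 0 within {0..}) sequentially"
    using LIMSEQ_inverse_real_of_nat by (auto simp: filterlim_at)
  from filterlim_compose[OF lim this] show ?thesis by (simp add: divide_inverse)
qed

text \<open>Extend \<open>Y\<close> by zero to the whole space. The difference quotients of the extension in direction \<open>i\<close>
  integrate to zero by translation invariance. They are taken with positive increments, so that they
  converge everywhere: to the derivative on the half-space, and to zero outside, whose points stay outside
  for small increments. They are bounded by a Lipschitz constant; in the normal direction, where the
  increment may enter the half-space, this is where the vanishing of \<open>Y\<close> on the boundary is used.\<close>
lemma half_space_integral_pd:
  fixes Y :: "real^'n::finite \<Rightarrow> real"
  assumes U: "hopen U" and K: "compact K" "K \<subseteq> U" and Y: "ck_on (Suc 0) U Y"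
    and off: "\<And>x. x \<in> U \<Longrightarrow> x \<notin> K \<Longrightarrow> Y x = 0"
    and bd: "\<And>x. i = bdry_coord \<Longrightarrow> x \<in> U \<Longrightarrow> x $ bdry_coord = 0 \<Longrightarrow> Y x = 0"
  shows "integrable lborel (\<lambda>x. indicator U x * pd i Y x)"
    and "(LINT x|lborel. indicator U x * pd i Y x) = 0"
proof -
  define Z where "Z x = (if x \<in> K then Y x else 0)" for x
  define e :: "real^'n" where "e = axis i 1"
  define \<epsilon> :: "nat \<Rightarrow> real" where "\<epsilon> m = inverse (real (Suc m))" for m
  define q where "q m x = (Z (x + \<epsilon> m *\<^sub>R e) - Z x) * real (Suc m)" for m x
  have H: "hopen (half_space :: (real^'n) set)" by simp
  have UH: "U \<subseteq> half_space" using hopen_subset[OF U] .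
  have Z1: "ck_on (Suc 0) half_space Z"
    unfolding Z_def using ck_on_extend_zero[OF U compact_imp_closed[OF K(1)] K(2) Y off] .
  have Zoff: "Z x = 0" if "x \<notin> K" for x using that by (simp add: Z_def)
  have ZU: "Z x = Y x" if "x \<in> U" for x using that off by (auto simp: Z_def)
  have \<epsilon>: "0 < \<epsilon> m" "\<epsilon> m \<le> 1" "\<epsilon> m * real (Suc m) = 1" for m by (auto simp: \<epsilon>_def field_simps)
  obtain B where B: "B \<ge> 0"
    "\<And>x y. x \<in> half_space \<Longrightarrow> y \<in> half_space \<Longrightarrow> \<bar>Z x - Z y\<bar> \<le> B * norm (x - y)"
    using half_space_lipschitz[OF Z1 K(1)] K(2) UH Zoff by blast
  have Zlip: "\<bar>Z (x + s *\<^sub>R e) - Z x\<bar> \<le> B * s" if s: "s \<ge> 0" for x s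
  proof (cases "x \<in> half_space")
    case True
    then have "x + s *\<^sub>R e \<in> half_space" using half_space_add s by (auto simp: e_def)
    from B(2)[OF this True] s show ?thesis by (simp add: e_def)
  next
    case x: False
    show ?thesis
    proof (cases "x + s *\<^sub>R e \<in> half_space")
      case True
      have i: "i = bdry_coord" using x True by (auto simp: half_space_def e_def axis_def split: if_splits)
      \<comment> \<open>The point where the segment enters the half-space.\<close>
      define z where "z = x + (- x $ bdry_coord) *\<^sub>R e"
      have z: "z $ bdry_coord = 0" "z \<in> half_space" by (auto simp: z_def e_def i half_space_def)
      then have "Z z = 0" using bd[OF i, of z] K(2) by (auto simp: Z_def)
      moreover have "Z x = 0" using x Zoff K(2) UH by auto
      moreover have "norm (x + s *\<^sub>R e - z) \<le> s"
      proof -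
        have "x + s *\<^sub>R e - z = (s + x $ bdry_coord) *\<^sub>R e" by (simp add: z_def algebra_simps)
        moreover have "0 \<le> s + x $ bdry_coord" "x $ bdry_coord \<le> 0"
          using True x by (auto simp: half_space_def e_def i)
        ultimately show ?thesis by (simp add: e_def)
      qed
      ultimately show ?thesis
        using B(2)[OF True z(2)] mult_left_mono[OF _ B(1)] by fastforce
    next
      case False
      then have "x \<notin> K" "x + s *\<^sub>R e \<notin> K" using x K(2) UH by auto
      then show ?thesis using s B(1) by (simp add: Zoff)
    qed
  qed
  obtain R where R: "K \<subseteq> cball 0 R" 
    using compact_imp_bounded[OF K(1)] by (auto simp: bounded_iff subset_eq)
  have fin: "integrable lborel (\<lambda>x. indicator (cball (0::real^'n) (R + 1)) x * C)" for C :: real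
    using borel_integrable_compact[of "cball (0::real^'n) (R+1)" "\<lambda>_. C"] by simp
  have qb: "\<bar>q m x\<bar> \<le> indicator (cball 0 (R + 1)) x * B" for m x
  proof (cases "x \<in> cball 0 (R + 1)")
    case True
    have "\<bar>q m x\<bar> \<le> B * \<epsilon> m * real (Suc m)"
      using Zlip[of "\<epsilon> m" x] \<epsilon>(1)[of m] by (auto simp: q_def abs_mult intro!: mult_right_mono)
    also have "\<dots> = B" using \<epsilon>(3)[of m] by (simp del: of_nat_Suc add: mult.assoc)
    finally show ?thesis using True by simp
  next
    case False
    \<comment> \<open>The increments are at most 1, so the quotient vanishes outside the enlarged ball.\<close>
    have "norm (x + \<epsilon> m *\<^sub>R e) \<ge> norm x - \<epsilon> m"
      using norm_diff_ineq[of x "\<epsilon> m *\<^sub>R e"] \<epsilon>(1)[of m] by (simp add: e_def)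
    then have "x \<notin> K" "x + \<epsilon> m *\<^sub>R e \<notin> K" using False R \<epsilon>(2)[of m] by (auto simp: subset_eq)
    then show ?thesis using B(1) by (simp add: q_def Zoff)
  qed
  have Zi: "integrable lborel Z"
  proof -
    have "continuous_on K Y" using K(2) Y ck_on_imp_continuous_on continuous_on_subset by blast
    from borel_integrable_compact[OF K(1) this]
    have "integrable lborel (\<lambda>x. indicator K x *\<^sub>R Y x)" .
    moreover have "(\<lambda>x. indicator K x *\<^sub>R Y x) = Z" by (auto simp: Z_def fun_eq_iff)
    ultimately show ?thesis by simp
  qed
  have Zm [measurable]: "Z \<in> borel_measurable borel"
    using borel_measurable_integrable[OF Zi] by simp
  have q0: "(LINT x|lborel. q m x) = 0" for m
  proof -
    have i: "integrable (distr lborel borel ((+) (\<epsilon> m *\<^sub>R e))) Z" using Zi by (simp add: lborel_distr_plus)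
    have "integrable lborel (\<lambda>x. Z (\<epsilon> m *\<^sub>R e + x))"
      using integrable_distr_eq[of "(+) (\<epsilon> m *\<^sub>R e)" lborel borel Z] i by simp
    moreover have "(LINT x|lborel. Z (\<epsilon> m *\<^sub>R e + x)) = (LINT x|lborel. Z x)"
      using integral_distr[of "(+) (\<epsilon> m *\<^sub>R e)" lborel borel Z] by (simp add: lborel_distr_plus)
    ultimately show ?thesis using Zi by (simp add: q_def add.commute)
  qed
  have lim: "(\<lambda>m. q m x) \<longlonglongrightarrow> indicator U x * pd i Y x" for x
  proof (cases "x \<in> half_space")
    case x: True
    have "pd i Z x = indicator U x * pd i Y x"
    proof (cases "x \<in> U")
      case True then show ?thesis using pd_cong[OF U True ZU] by simp
    next
      case False
      have V: "hopen (half_space - K)"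
        using K by (auto simp: openin_open compact_imp_closed intro!: exI[of _ "- K"])
      have "x \<in> half_space - K" using False x K by blast
      from pd_cong[OF V this, of Z "\<lambda>_. 0"] Zoff have "pd i Z x = pd i (\<lambda>_. 0) x" by simp
      also have "\<dots> = 0" using pd_eq[of "\<lambda>_. 0" "\<lambda>_. 0" x i] x by simp
      finally show ?thesis using False by simp
    qed
    then show ?thesis
      using hderiv_quotient[OF ck_on_deriv[OF H Z1 x] x, of i] by (simp add: q_def \<epsilon>_def e_def)
  next
    case False
    have "(\<lambda>m. x + \<epsilon> m *\<^sub>R e) \<longlonglongrightarrow> x + 0 *\<^sub>R e"
      unfolding \<epsilon>_def by (intro tendsto_intros LIMSEQ_inverse_real_of_nat)
    moreover have "open (- half_space :: (real^'n) set)" by (rule open_Compl[OF closed_half_space])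
    ultimately have "\<forall>\<^sub>F m in sequentially. x + \<epsilon> m *\<^sub>R e \<in> - half_space"
      
    using topological_tendstoD[of "\<lambda>m. x + \<epsilon> m *\<^sub>R e" x sequentially "- half_space"] False
    by simp
    then have "\<forall>\<^sub>F m in sequentially. q m x = 0"
    proof (rule eventually_mono)
      fix m assume "x + \<epsilon> m *\<^sub>R e \<in> - half_space"
      then have "x + \<epsilon> m *\<^sub>R e \<notin> K" "x \<notin> K" using False K UH by auto
      then show "q m x = 0" using Zoff by (simp add: q_def)
    qed
    moreover have "x \<notin> U" using False UH by auto
    ultimately show ?thesis by (simp add: tendsto_eventually)
  qed
  have qm [measurable]: "q m \<in> borel_measurable lborel" for m unfolding q_def by measurable
  have lm: "(\<lambda>x. indicator U x * pd i Y x) \<in> borel_measurable lborel"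
    by (rule borel_measurable_LIMSEQ_real[OF lim qm])
  show "integrable lborel (\<lambda>x. indicator U x * pd i Y x)"
    by (rule integrable_dominated_convergence[where s = q, OF lm qm fin[of B]]) (use lim qb in auto)
  have "(\<lambda>m. LINT x|lborel. q m x) \<longlonglongrightarrow> (LINT x|lborel. indicator U x * pd i Y x)"
    by (rule integral_dominated_convergence[where s = q, OF lm qm fin[of B]]) (use lim qb in auto)
  then show "(LINT x|lborel. indicator U x * pd i Y x) = 0"
    by (simp add: q0 LIMSEQ_const_iff)
qed

section \<open>Charts, tangent vectors and gradients\<close>

text \<open>The segment from the identity to \<open>A\<close> consists of positive definite, hence invertible, matrices, so
  the determinant keeps the sign that it has at the identity.\<close>
lemma pos_def_imp_det_pos:
  fixes A :: "real^'n::finite^'n"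
  assumes "\<And>v. v \<noteq> 0 \<Longrightarrow> 0 < v \<bullet> (A *v v)"
  shows "0 < det A"
proof -
  define B where "B t = (1 - t) *\<^sub>R mat 1 + t *\<^sub>R A" for t :: real
  have nz: "det (B t) \<noteq> 0" if t: "0 \<le> t" "t \<le> 1" for t
  proof
    assume "det (B t) = 0"
    then obtain v where v: "B t *v v = 0" "v \<noteq> 0"
      by (metis invertible_det_nz invertible_left_inverse matrix_left_invertible_ker)
    have "B t *v v = (1 - t) *\<^sub>R v + t *\<^sub>R (A *v v)"
      unfolding B_def by (simp add: matrix_vector_mult_add_rdistrib scaleR_matrix_vector_assoc[symmetric])
    with v(1) have "(1 - t) * (v \<bullet> v) + t * (v \<bullet> (A *v v)) = 0"
      by (metis inner_add_right inner_scaleR_right inner_zero_right)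
    moreover have "0 \<le> (1 - t) * (v \<bullet> v)" "0 \<le> t * (v \<bullet> (A *v v))"
      using t assms[OF v(2)] by auto
    ultimately have "(1 - t) * (v \<bullet> v) = 0" "t * (v \<bullet> (A *v v)) = 0" by linarith+
    then show False using assms[OF v(2)] v(2) by auto
  qed
  have cont: "continuous_on {0..1} (\<lambda>t. det (B t))"
    unfolding det_def B_def by (auto intro!: continuous_intros simp: mat_def)
  show ?thesis
  proof (rule ccontr)
    assume "\<not> 0 < det A"
    then have "det (B 1) \<le> 0" "0 \<le> det (B 0)" by (auto simp: B_def)
    from IVT2'[of "\<lambda>t. det (B t)", OF this _ cont] nz show False by auto
  qed
qed

text \<open>Along the bounding hyperplane both \<open>x + s u\<close> and \<open>x - s u\<close> stay in the half-space, so the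
  first-order condition at a minimum holds in such directions even at boundary points. Applied to the boundary
  coordinate of a transition map, it says that vectors tangent to the boundary stay so in another chart.\<close>
lemma hderiv_zero_at_minimum:
  fixes h :: "real^'n::finite \<Rightarrow> real"
  assumes U: "hopen U" "x \<in> U" and nonneg: "\<And>y. y \<in> U \<Longrightarrow> 0 \<le> h y" and zero: "h x = 0"
    and D: "(h has_derivative D) (at x within half_space)"
    and u: "u $ bdry_coord = 0"
  shows "D u = 0"
proof -
  have lin: "linear D" using D by (simp add: has_derivative_linear)
  have xH: "0 \<le> x $ bdry_coord" using hopen_subset[OF U(1)] U(2) by (auto simp: half_space_def)
  obtain r where r: "r > 0" "cball x r \<inter> half_space \<subseteq> U" using hopen_ball[OF U] .
  define \<epsilon> where "\<epsilon> = r / (norm u + 1)"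
  have \<epsilon>: "\<epsilon> > 0" using r(1) by (simp add: \<epsilon>_def add_nonneg_pos)
  have inU: "x + s *\<^sub>R u \<in> U" if s: "\<bar>s\<bar> < \<epsilon>" for s
  proof -
    have "\<bar>s\<bar> * (norm u + 1) < r"
      using s by (simp add: \<epsilon>_def pos_less_divide_eq add_nonneg_pos)
    then have "norm (s *\<^sub>R u) \<le> r" using abs_ge_zero[of s] by (simp add: distrib_left)
    then show ?thesis using r(2) xH u by (auto simp: half_space_def dist_norm)
  qed
  let ?I = "{- \<epsilon><..<\<epsilon>}"
  have "((\<lambda>s. x + s *\<^sub>R u) has_derivative (\<lambda>s. s *\<^sub>R u)) (at 0 within ?I)"
    by (auto intro!: derivative_eq_intros)
  moreover have "(h has_derivative D) (at (x + 0 *\<^sub>R u) within (\<lambda>s. x + s *\<^sub>R u) ` ?I)"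
  proof -
    have "(\<lambda>s. x + s *\<^sub>R u) ` ?I \<subseteq> half_space" using inU hopen_subset[OF U(1)] by force
    from has_derivative_subset[OF D this] show ?thesis by simp
  qed
  ultimately have "((\<lambda>s. h (x + s *\<^sub>R u)) has_derivative (\<lambda>s. D (s *\<^sub>R u))) (at 0 within ?I)"
    by (rule has_derivative_in_compose)
  then have "((\<lambda>s. h (x + s *\<^sub>R u)) has_real_derivative D u) (at 0)"
    using at_within_open[of "0::real" ?I] \<epsilon>
    by (simp add: has_field_derivative_def linear_scale[OF lin] mult.commute[of _ "D u"])
  then show ?thesis
    by (rule DERIV_local_min[OF _ \<epsilon>]) (use zero nonneg inU in auto)
qed

locale compact_riemannian =
  fixes M :: "('m::{t2_space, second_countable_topology}, 'n::finite) riem"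
  assumes manifold: "riemannian_manifold M" and compact: "compact (UNIV :: 'm set)"
begin

lemma chart_facts:
  assumes "a \<in> atlas M"
  shows open_chart: "open (fst a)" and hopen_image: "hopen (chart_image a)"
    and chart_homeo: "homeomorphism (fst a) (chart_image a) (snd a) (chart_inv a)"
  using manifold assms by (auto simp: riemannian_manifold_def smooth_atlas_def is_chart_def)

lemma chart_inv_in [simp]: "a \<in> atlas M \<Longrightarrow> x \<in> chart_image a \<Longrightarrow> chart_inv a x \<in> fst a"
  using homeomorphism_image2[OF chart_homeo[of a]] by blast

lemma chart_chart_inv [simp]: "a \<in> atlas M \<Longrightarrow> x \<in> chart_image a \<Longrightarrow> snd a (chart_inv a x) = x"
  by (rule homeomorphism_apply2[OF chart_homeo])

lemma chart_inv_chart [simp]: "a \<in> atlas M \<Longrightarrow> p \<in> fst a \<Longrightarrow> chart_inv a (snd a p) = p"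
  by (rule homeomorphism_apply1[OF chart_homeo])

lemma chart_in_image [simp]: "p \<in> fst a \<Longrightarrow> snd a p \<in> chart_image a"
  by (simp add: chart_image_def)

lemma image_subset_half_space: "a \<in> atlas M \<Longrightarrow> x \<in> chart_image a \<Longrightarrow> x \<in> half_space"
  by (rule subsetD[OF hopen_subset[OF hopen_image]])

lemma chart_at: "chart_at M p \<in> atlas M" "p \<in> fst (chart_at M p)"
proof -
  have "\<exists>a. a \<in> atlas M \<and> p \<in> fst a"
    using manifold by (force simp: riemannian_manifold_def smooth_atlas_def)
  from someI_ex[OF this] show "chart_at M p \<in> atlas M" "p \<in> fst (chart_at M p)"
    by (auto simp: chart_at_def)
qed

lemma hopen_chart: 
  assumes "a \<in> atlas M" "open N"
  shows "hopen (snd a ` (fst a \<inter> N))"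
  by (rule openin_trans[OF homeomorphism_imp_open_map[OF chart_homeo[OF assms(1)]
        openin_open_Int[OF assms(2)]] hopen_image[OF assms(1)]])

lemma hopen_overlap: "a \<in> atlas M \<Longrightarrow> b \<in> atlas M \<Longrightarrow> hopen (snd a ` (fst a \<inter> fst b))"
  by (rule hopen_chart[OF _ open_chart])

lemma transition_deriv_eq:
  assumes "a \<in> atlas M" "b \<in> atlas M" "p \<in> fst a" "p \<in> fst b"
  shows "transition_deriv a b p = hderiv (snd b \<circ> chart_inv a) (snd a p)"
  unfolding transition_deriv_def using hopen_at_within[OF hopen_overlap[OF assms(1,2)]] assms by auto

lemma transition_ck:
  assumes "a \<in> atlas M" "b \<in> atlas M"
  shows "ck_on k (snd a ` (fst a \<inter> fst b)) (snd b \<circ> chart_inv a)"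
  using manifold assms by (auto simp: riemannian_manifold_def smooth_atlas_def smooth_on_def)

lemma transition_has_deriv:
  assumes "a \<in> atlas M" "b \<in> atlas M" "p \<in> fst a" "p \<in> fst b"
  shows "((snd b \<circ> chart_inv a) has_derivative transition_deriv a b p) (at (snd a p) within half_space)"
  unfolding transition_deriv_eq[OF assms]
  using assms by (intro ck_on_deriv[OF hopen_overlap[OF assms(1,2)] transition_ck[OF assms(1,2), of "Suc 0"]]) simp

lemma transition_linear:
  assumes "a \<in> atlas M" "b \<in> atlas M" "p \<in> fst a" "p \<in> fst b"
  shows "linear (transition_deriv a b p)"
  by (rule has_derivative_linear[OF transition_has_deriv[OF assms]])

text \<open>The chain rule for a change of charts. It applies to vector-valued \<open>f\<close>, in particular to a third
  chart, where it becomes the cocycle condition for the derivatives of the transition maps.\<close>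
lemma chart_chain:
  fixes f :: "'m \<Rightarrow> 'b::real_normed_vector"
  assumes ab: "a \<in> atlas M" "b \<in> atlas M" "p \<in> fst a" "p \<in> fst b"
    and D: "((f \<circ> chart_inv b) has_derivative D) (at (snd b p) within half_space)"
  shows "((f \<circ> chart_inv a) has_derivative (\<lambda>u. D (transition_deriv a b p u))) (at (snd a p) within half_space)"
proof -
  let ?V = "snd a ` (fst a \<inter> fst b)"
  have V: "hopen ?V" "snd a p \<in> ?V" using hopen_overlap ab by auto
  have im: "(snd b \<circ> chart_inv a) ` ?V \<subseteq> half_space"
    using ab image_subset_half_space[OF ab(2) chart_in_image] by auto
  have 1: "((snd b \<circ> chart_inv a) has_derivative transition_deriv a b p) (at (snd a p) within ?V)"
    using transition_has_deriv[OF ab] hopen_at_within[OF V] by simp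
  have 2: "((f \<circ> chart_inv b) has_derivative D)
      (at ((snd b \<circ> chart_inv a) (snd a p)) within (snd b \<circ> chart_inv a) ` ?V)"
    using has_derivative_subset[OF D im] ab by simp
  from has_derivative_in_compose[OF 1 2] have
    "((\<lambda>x. (f \<circ> chart_inv b) ((snd b \<circ> chart_inv a) x)) has_derivative (\<lambda>u. D (transition_deriv a b p u)))
      (at (snd a p) within half_space)"
    using hopen_at_within[OF V] by simp
  moreover have "(f \<circ> chart_inv b) ((snd b \<circ> chart_inv a) x) = (f \<circ> chart_inv a) x" if "x \<in> ?V" for x
    using that ab by auto
  ultimately show ?thesis
    using has_hderiv_cong[OF V, of "\<lambda>x. (f \<circ> chart_inv b) ((snd b \<circ> chart_inv a) x)" "f \<circ> chart_inv a"]
    by simp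
qed

lemma transition_compose:
  assumes "a \<in> atlas M" "b \<in> atlas M" "c \<in> atlas M" "p \<in> fst a" "p \<in> fst b" "p \<in> fst c"
  shows "transition_deriv b c p (transition_deriv a b p u) = transition_deriv a c p u"
proof -
  have "((snd c \<circ> chart_inv a) has_derivative (\<lambda>u. transition_deriv b c p (transition_deriv a b p u)))
     (at (snd a p) within half_space)"
    using assms by (intro chart_chain transition_has_deriv) auto
  then have "hderiv (snd c \<circ> chart_inv a) (snd a p) = (\<lambda>u. transition_deriv b c p (transition_deriv a b p u))"
    using hderiv_unique image_subset_half_space chart_in_image assms by metis
  then show ?thesis using assms by (simp add: transition_deriv_eq[of a c])
qed

lemma transition_id:
  assumes "a \<in> atlas M" "p \<in> fst a"
  shows "transition_deriv a a p u = u"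
proof -
  have "((\<lambda>x. x) has_derivative (\<lambda>u. u)) (at (snd a p) within half_space)" by simp
  then have "(snd a \<circ> chart_inv a has_derivative (\<lambda>u. u)) (at (snd a p) within half_space)"
    using has_hderiv_cong[OF hopen_image[OF assms(1)] chart_in_image[OF assms(2)],
        of "snd a \<circ> chart_inv a" "\<lambda>x. x"] assms by auto
  then show ?thesis
    using hderiv_unique image_subset_half_space chart_in_image assms transition_deriv_eq by metis
qed

lemma to_from_chart [simp]:
  assumes "a \<in> atlas M" "p \<in> fst a"
  shows "to_chart M a p (from_chart M a p u) = u" "from_chart M a p (to_chart M a p u) = u"
  using assms chart_at by (simp_all add: to_chart_def from_chart_def transition_compose transition_id)

lemma linear_to_chart: "a \<in> atlas M \<Longrightarrow> p \<in> fst a \<Longrightarrow> linear (to_chart M a p)"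
  using chart_at by (simp add: to_chart_def transition_linear)

lemma linear_from_chart: "a \<in> atlas M \<Longrightarrow> p \<in> fst a \<Longrightarrow> linear (from_chart M a p)"
  using chart_at by (simp add: from_chart_def transition_linear)

lemma transition_boundary_direction:
  assumes ab: "a \<in> atlas M" "b \<in> atlas M" "p \<in> fst a" "p \<in> fst b"
    and "snd b p $ bdry_coord = 0" "u $ bdry_coord = 0"
  shows "transition_deriv a b p u $ bdry_coord = 0"
proof (rule hderiv_zero_at_minimum[where h = "\<lambda>x. (snd b \<circ> chart_inv a) x $ bdry_coord"
      and U = "snd a ` (fst a \<inter> fst b)" and x = "snd a p"
      and D = "\<lambda>u. transition_deriv a b p u $ bdry_coord"])
  show "((\<lambda>x. (snd b \<circ> chart_inv a) x $ bdry_coord) has_derivative (\<lambda>u. transition_deriv a b p u $ bdry_coord))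
     (at (snd a p) within half_space)"
    using bounded_linear.has_derivative[OF bounded_linear_vec_nth transition_has_deriv[OF ab]] .
  show "0 \<le> (snd b \<circ> chart_inv a) y $ bdry_coord" if y: "y \<in> snd a ` (fst a \<inter> fst b)" for y
  proof -
    obtain q where "q \<in> fst a" "q \<in> fst b" "y = snd a q" using y by blast
    then show ?thesis using ab image_subset_half_space[OF ab(2), of "snd b q"] by (simp add: half_space_def)
  qed
qed (use assms hopen_overlap[OF ab(1,2)] in simp_all)

lemma metric_bilinear: "bilinear (metric M p)"
  and metric_sym: "metric M p u v = metric M p v u"
  and metric_pos: "u \<noteq> 0 \<Longrightarrow> 0 < metric M p u u"
  using manifold by (auto simp: riemannian_manifold_def riemannian_metric_def)

lemmas metric_simps = bilinear_ladd[OF metric_bilinear] bilinear_radd[OF metric_bilinear]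
  bilinear_lmul[OF metric_bilinear] bilinear_rmul[OF metric_bilinear]
  bilinear_lsub[OF metric_bilinear] bilinear_rsub[OF metric_bilinear]
  bilinear_lneg[OF metric_bilinear] bilinear_rneg[OF metric_bilinear]
  bilinear_lzero[OF metric_bilinear] bilinear_rzero[OF metric_bilinear]

lemma metric_nonneg: "0 \<le> metric M p u u"
  using metric_pos[of u p] metric_simps by (cases "u = 0") auto

text \<open>Tangency is expressed through the metric at \<open>p\<close>. In the preferred chart it means that the boundary
  coordinate of \<open>w p\<close> vanishes: some multiple of the normal has the same boundary coordinate, their
  difference is orthogonal to the normal, and so the multiple is zero. The transition to the chart \<open>a\<close>
  preserves this.\<close>
lemma tangential_boundary:
  assumes "w \<in> tangential_fields M" "a \<in> atlas M" "x \<in> chart_image a" "x $ bdry_coord = 0"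
  shows "coord_field M a w x $ bdry_coord = 0"
proof -
  define p where "p = chart_inv a x"
  have p: "p \<in> fst a" "snd a p = x" using assms by (auto simp: p_def)
  have pb: "p \<in> boundary M" using assms p by (auto simp: boundary_def)
  define n where "n = normal M p"
  have n: "metric M p n n = 1" "n $ bdry_coord < 0" "\<And>u. u $ bdry_coord = 0 \<Longrightarrow> metric M p n u = 0"
    using manifold pb by (auto simp: riemannian_manifold_def outward_unit_normal_def n_def)
  define \<alpha> where "\<alpha> = w p $ bdry_coord / n $ bdry_coord"
  have "metric M p n (w p - \<alpha> *\<^sub>R n) = 0" using n(2) by (intro n(3)) (simp add: \<alpha>_def)
  moreover have "metric M p n (w p) = 0"
    using assms(1) pb by (simp add: tangential_fields_def n_def metric_sym)
  ultimately have "\<alpha> = 0" using n(1) by (simp add: metric_simps)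
  then have "w p $ bdry_coord = 0" using n(2) by (simp add: \<alpha>_def)
  then show ?thesis
    using transition_boundary_direction[OF chart_at(1) assms(2) chart_at(2) p(1)] p assms(4)
    by (simp add: coord_field_def to_chart_def p_def[symmetric])
qed

subsection \<open>The gradient in a chart\<close>

text \<open>Finite differentiability is kept because the bump functions are only of class \<open>C\<^sup>1\<close>.\<close>
definition ck_fun :: "nat \<Rightarrow> ('m \<Rightarrow> real) \<Rightarrow> bool" where
  "ck_fun k f \<longleftrightarrow> (\<forall>a\<in>atlas M. ck_on k (chart_image a) (f \<circ> chart_inv a))"

lemma ck_funD: "ck_fun k f \<Longrightarrow> a \<in> atlas M \<Longrightarrow> ck_on k (chart_image a) (f \<circ> chart_inv a)"
  by (simp add: ck_fun_def)

lemma smooth_fun_iff: "smooth_fun M f \<longleftrightarrow> (\<forall>k. ck_fun k f)"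
  by (auto simp: smooth_fun_def smooth_on_def ck_fun_def)

lemma ck_fun_deriv:
  assumes "ck_fun (Suc k) f" "a \<in> atlas M" "x \<in> chart_image a"
  shows "((f \<circ> chart_inv a) has_derivative hderiv (f \<circ> chart_inv a) x) (at x within half_space)"
  using assms by (intro ck_on_deriv[OF hopen_image]) (auto simp: ck_fun_def simp del: ck_on.simps)

lemma dfun_chart_at: "dfun M f p = hderiv (f \<circ> chart_inv (chart_at M p)) (snd (chart_at M p) p)"
  unfolding dfun_def using hopen_at_within[OF hopen_image[OF chart_at(1)]] chart_at(2) by simp

lemma dfun_chart:
  assumes "ck_fun (Suc k) f" "a \<in> atlas M" "p \<in> fst a"
  shows "dfun M f p u = hderiv (f \<circ> chart_inv a) (snd a p) (to_chart M a p u)"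
proof -
  have "((f \<circ> chart_inv (chart_at M p)) has_derivative
      (\<lambda>u. hderiv (f \<circ> chart_inv a) (snd a p) (to_chart M a p u))) (at (snd (chart_at M p) p) within half_space)"
    unfolding to_chart_def using assms chart_at by (intro chart_chain ck_fun_deriv) auto
  from hderiv_unique[OF this] show ?thesis
    using image_subset_half_space[OF chart_at(1) chart_in_image[OF chart_at(2)]] by (simp add: dfun_chart_at)
qed

lemma dfun_linear: "ck_fun (Suc k) f \<Longrightarrow> linear (dfun M f p)"
  unfolding dfun_chart_at using ck_fun_deriv chart_at chart_in_image has_derivative_linear by metis

lemma dfun_coord:
  assumes "ck_fun (Suc k) f" "a \<in> atlas M" "x \<in> chart_image a"
  shows "dfun M f (chart_inv a x) (w (chart_inv a x)) =
    (\<Sum>i\<in>UNIV. coord_field M a w x $ i * pd i (f \<circ> chart_inv a) x)"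
  using assms hderiv_linear[OF ck_fun_deriv[OF assms]] by (simp add: dfun_chart coord_field_def)

text \<open>Existence of the gradient is the Riesz representation theorem in finite dimension: the map from \<open>v\<close> to
  the coordinates of \<open>g(v, _)\<close> is injective by positivity, hence onto.\<close>
lemma metric_grad:
  assumes "ck_fun (Suc k) f"
  shows "metric M p (grad M f p) u = dfun M f p u"
proof -
  have ex: "\<exists>v. \<forall>u. metric M p v u = dfun M f p u"
  proof -
    define T where "T v = (\<chi> i. metric M p v (axis i 1))" for v
    have T: "linear T" by (rule linearI) (auto simp: T_def vec_eq_iff metric_simps)
    have expand: "metric M p v u = T v \<bullet> u" for v u
    proof -
      have l: "linear (metric M p v)" using metric_bilinear[of p] by (simp add: bilinear_def)
      have "u = (\<Sum>i\<in>UNIV. (u $ i) *\<^sub>R axis i 1)"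
        by (metis (no_types, lifting) basis_expansion scalar_mult_eq_scaleR sum.cong)
      then have "metric M p v u = metric M p v (\<Sum>i\<in>UNIV. (u $ i) *\<^sub>R axis i 1)" by simp
      also have "\<dots> = T v \<bullet> u"
        by (simp add: linear_sum[OF l] linear_scale[OF l] inner_vec_def T_def mult.commute)
      finally show ?thesis .
    qed
    have "inj T"
    proof (subst linear_injective_0[OF T], intro allI impI)
      fix v assume "T v = 0"
      then have "metric M p v v = 0" by (simp add: expand)
      then show "v = 0" using metric_pos[of v p] by force
    qed
    then have "surj T" using linear_injective_imp_surjective[OF T] by blast
    then obtain v where v: "T v = (\<chi> i. dfun M f p (axis i 1))" by (metis surjD)
    have "dfun M f p u = T v \<bullet> u" for u
    proof -
      note l = dfun_linear[OF assms, of p]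
      have "u = (\<Sum>i\<in>UNIV. (u $ i) *\<^sub>R axis i 1)"
        by (metis (no_types, lifting) basis_expansion scalar_mult_eq_scaleR sum.cong)
      then have "dfun M f p u = dfun M f p (\<Sum>i\<in>UNIV. (u $ i) *\<^sub>R axis i 1)" by simp
      also have "\<dots> = T v \<bullet> u"
        by (simp add: v linear_sum[OF l] linear_scale[OF l] inner_vec_def mult.commute)
      finally show ?thesis .
    qed
    then show ?thesis using expand by auto
  qed
  have "v = v'" if "\<forall>u. metric M p v u = dfun M f p u" "\<forall>u. metric M p v' u = dfun M f p u" for v v'
  proof (rule ccontr)
    assume "v \<noteq> v'"
    then have "0 < metric M p (v - v') (v - v')" using metric_pos by simp
    then show False using that by (simp add: metric_simps)
  qed
  with ex have "\<exists>!v. \<forall>u. metric M p v u = dfun M f p u" by blast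
  from theI'[OF this] show ?thesis by (simp add: grad_def)
qed

lemma gram_ck:
  assumes "a \<in> atlas M"
  shows "ck_on k (chart_image a) (\<lambda>x. gram M a x $ i $ j)"
  using manifold assms by (auto simp: riemannian_manifold_def riemannian_metric_def smooth_on_def)

lemma gram_mult:
  assumes "a \<in> atlas M" "x \<in> chart_image a"
  shows "(gram M a x *v v) $ i =
    metric M (chart_inv a x) (from_chart M a (chart_inv a x) (axis i 1)) (from_chart M a (chart_inv a x) v)"
proof -
  define p where "p = chart_inv a x"
  have l: "linear (\<lambda>v. metric M p (from_chart M a p (axis i 1)) (from_chart M a p v))"
    using linear_compose[OF linear_from_chart, of a p "metric M p (from_chart M a p (axis i 1))"]
      assms metric_bilinear by (auto simp: p_def bilinear_def o_def)
  have "v = (\<Sum>j\<in>UNIV. (v $ j) *\<^sub>R axis j 1)"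
    by (metis (no_types, lifting) basis_expansion scalar_mult_eq_scaleR sum.cong)
  then have "metric M p (from_chart M a p (axis i 1)) (from_chart M a p v) =
     metric M p (from_chart M a p (axis i 1)) (from_chart M a p (\<Sum>j\<in>UNIV. (v $ j) *\<^sub>R axis j 1))" by simp
  also have "\<dots> = (\<Sum>j\<in>UNIV. v $ j * metric M p (from_chart M a p (axis i 1)) (from_chart M a p (axis j 1)))"
    using linear_sum[OF l, of "\<lambda>j. (v $ j) *\<^sub>R axis j 1" UNIV] by (simp add: linear_scale[OF l])
  finally show ?thesis by (simp add: matrix_vector_mult_def gram_def p_def mult.commute)
qed

lemma metric_gram:
  assumes "a \<in> atlas M" "x \<in> chart_image a"
  shows "metric M (chart_inv a x) (from_chart M a (chart_inv a x) u) (from_chart M a (chart_inv a x) v) =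
    u \<bullet> (gram M a x *v v)"
proof -
  define p where "p = chart_inv a x"
  have p: "p \<in> fst a" using assms by (simp add: p_def)
  note l = linear_from_chart[OF assms(1) p]
  have l2: "linear (\<lambda>u. metric M p u (from_chart M a p v))"
    using metric_bilinear by (auto simp: bilinear_def)
  have "u = (\<Sum>i\<in>UNIV. (u $ i) *\<^sub>R axis i 1)"
    by (metis (no_types, lifting) basis_expansion scalar_mult_eq_scaleR sum.cong)
  then have "metric M p (from_chart M a p u) (from_chart M a p v) =
      metric M p (from_chart M a p (\<Sum>i\<in>UNIV. (u $ i) *\<^sub>R axis i 1)) (from_chart M a p v)" by simp
  also have "\<dots> = (\<Sum>i\<in>UNIV. u $ i * metric M p (from_chart M a p (axis i 1)) (from_chart M a p v))"
    by (simp add: linear_sum[OF l] linear_scale[OF l] linear_sum[OF l2] metric_simps)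
  also have "\<dots> = u \<bullet> (gram M a x *v v)"
    by (simp add: inner_vec_def gram_mult[OF assms] p_def)
  finally show ?thesis by (simp add: p_def)
qed

lemma gram_det_pos:
  assumes "a \<in> atlas M" "x \<in> chart_image a"
  shows "0 < det (gram M a x)"
proof (rule pos_def_imp_det_pos)
  fix v :: "real^'n" assume v: "v \<noteq> 0"
  have p: "chart_inv a x \<in> fst a" using assms by simp
  have "from_chart M a (chart_inv a x) v \<noteq> 0"
    using to_from_chart(1)[OF assms(1) p, of v] linear_0[OF linear_to_chart[OF assms(1) p]] v by auto
  then show "0 < v \<bullet> (gram M a x *v v)" unfolding metric_gram[OF assms, symmetric] by (rule metric_pos)
qed

lemma vol_density_pos: "a \<in> atlas M \<Longrightarrow> x \<in> chart_image a \<Longrightarrow> 0 < vol_density M a x"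
  using gram_det_pos by (simp add: vol_density_def)

lemma vol_density_ck: "a \<in> atlas M \<Longrightarrow> ck_on k (chart_image a) (vol_density M a)"
  unfolding vol_density_def[abs_def]
  using gram_ck gram_det_pos by (intro ck_on_sqrt ck_on_det hopen_image) auto

lemma smooth_field_comp:
  assumes "smooth_field M w" "a \<in> atlas M"
  shows "ck_on k (chart_image a) (\<lambda>x. coord_field M a w x $ i)"
  using assms ck_on_component[OF hopen_image[of a]]
  unfolding smooth_field_def smooth_on_def by blast

lemma smooth_fieldI:
  assumes "\<And>a k i. a \<in> atlas M \<Longrightarrow> ck_on k (chart_image a) (\<lambda>x. coord_field M a w x $ i)"
  shows "smooth_field M w"
  using assms ck_on_component[OF hopen_image]
  unfolding smooth_field_def smooth_on_def by blast

text \<open>In coordinates the gradient solves the linear system with the Gram matrix and the partial derivatives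
  of \<open>f\<close>; by Cramer's rule its components are quotients of determinants with smooth entries.\<close>
lemma grad_smooth_field:
  assumes "smooth_fun M f"
  shows "smooth_field M (grad M f)"
proof (rule smooth_fieldI)
  fix a k i assume a: "a \<in> atlas M"
  have ck: "ck_fun k f" for k using assms by (simp add: smooth_fun_iff)
  let ?U = "chart_image a"
  define A where "A x = (\<chi> r s. if s = i then pd r (f \<circ> chart_inv a) x else gram M a x $ r $ s)" for x
  have eq: "coord_field M a (grad M f) x $ i = det (A x) * inverse (det (gram M a x))" if x: "x \<in> ?U" for x
  proof -
    define p where "p = chart_inv a x"
    have p: "p \<in> fst a" using a x by (simp add: p_def)
    have "gram M a x *v coord_field M a (grad M f) x = (\<chi> r. pd r (f \<circ> chart_inv a) x)"
    proof (subst vec_eq_iff, intro allI)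
      fix r
      have "(gram M a x *v coord_field M a (grad M f) x) $ r =
          metric M p (from_chart M a p (axis r 1)) (grad M f p)"
        using p a by (simp add: gram_mult[OF a x] coord_field_def p_def[symmetric])
      also have "\<dots> = dfun M f p (from_chart M a p (axis r 1))"
        by (subst metric_sym) (rule metric_grad[OF ck])
      also have "\<dots> = pd r (f \<circ> chart_inv a) x"
        using dfun_chart[OF ck a p] a p x by (simp add: pd_def p_def)
      finally show "(gram M a x *v coord_field M a (grad M f) x) $ r = (\<chi> r. pd r (f \<circ> chart_inv a) x) $ r"
        by simp
    qed
    from iffD1[OF cramer[OF less_imp_neq[OF gram_det_pos[OF a x], symmetric]] this]
    have "coord_field M a (grad M f) x $ i =
      (\<chi> k. det (\<chi> r s. if s = k then (\<chi> r. pd r (f \<circ> chart_inv a) x) $ r else gram M a x $ r $ s)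
        / det (gram M a x)) $ i" by (rule arg_cong)
    then show ?thesis by (simp add: A_def divide_inverse cong: if_cong)
  qed
  have "ck_on k ?U (\<lambda>x. A x $ r $ s)" for r s
  proof (cases "s = i")
    case True
    then show ?thesis
      using ck_on_pd[OF hopen_image[OF a] ck_funD[OF ck a], of k r] by (simp add: A_def)
  qed (use gram_ck[OF a] in \<open>simp add: A_def\<close>)
  note A = ck_on_det[OF hopen_image[OF a] this]
  have "ck_on k ?U (\<lambda>x. inverse (det (gram M a x)))"
    by (rule ck_on_inverse[OF hopen_image[OF a] _ ck_on_det[OF hopen_image[OF a] gram_ck[OF a]]])
      (use gram_det_pos[OF a] in force)
  note ck_on_mult[OF hopen_image[OF a] A this]
  then show "ck_on k ?U (\<lambda>x. coord_field M a (grad M f) x $ i)"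
    using ck_on_cong[OF hopen_image[OF a] eq, where k = k] by simp
qed

lemma scale_smooth_field:
  assumes "smooth_fun M f" "smooth_field M w"
  shows "smooth_field M (\<lambda>p. f p *\<^sub>R w p)"
proof (rule smooth_fieldI)
  fix a k i assume a: "a \<in> atlas M"
  have ck: "ck_on k (chart_image a) (\<lambda>x. (f \<circ> chart_inv a) x * coord_field M a w x $ i)"
    by (rule ck_on_mult[OF hopen_image[OF a] ck_funD[OF _ a] smooth_field_comp[OF assms(2) a]])
      (use assms(1) in \<open>simp add: smooth_fun_iff\<close>)
  have eq: "(f \<circ> chart_inv a) x * coord_field M a w x $ i = coord_field M a (\<lambda>p. f p *\<^sub>R w p) x $ i"
    if "x \<in> chart_image a" for x
    using that a by (simp add: coord_field_def linear_scale[OF linear_to_chart])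
  show "ck_on k (chart_image a) (\<lambda>x. coord_field M a (\<lambda>p. f p *\<^sub>R w p) x $ i)"
    by (rule iffD1[OF ck_on_cong[OF hopen_image[OF a] eq] ck])
qed

lemma add_smooth_field:
  assumes "smooth_field M v" "smooth_field M w"
  shows "smooth_field M (\<lambda>p. v p + w p)"
proof (rule smooth_fieldI)
  fix a k i assume a: "a \<in> atlas M"
  have ck: "ck_on k (chart_image a) (\<lambda>x. coord_field M a v x $ i + coord_field M a w x $ i)"
    by (intro ck_on_add[OF hopen_image[OF a]] smooth_field_comp assms a)
  have eq: "coord_field M a v x $ i + coord_field M a w x $ i = coord_field M a (\<lambda>p. v p + w p) x $ i"
    if "x \<in> chart_image a" for x
    using that a by (simp add: coord_field_def linear_add[OF linear_to_chart])
  show "ck_on k (chart_image a) (\<lambda>x. coord_field M a (\<lambda>p. v p + w p) x $ i)"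
    by (rule iffD1[OF ck_on_cong[OF hopen_image[OF a] eq] ck])
qed

end

section \<open>Integration and bump functions on the manifold\<close>

text \<open>The second power makes the truncated function differentiable at the origin, which is all that a
  \<open>C\<^sup>1\<close> bump requires.\<close>
lemma DERIV_max_square:
  "((\<lambda>u::real. (max 0 u)\<^sup>2) has_real_derivative 2 * max 0 u) (at u)"
proof -
  consider "u > 0" | "u < 0" | "u = 0" by linarith
  then show ?thesis
  proof cases
    case 1
    have "((\<lambda>u::real. u\<^sup>2) has_real_derivative 2 * u) (at u)"
      by (auto intro!: derivative_eq_intros)
    then have "((\<lambda>u::real. (max 0 u)\<^sup>2) has_real_derivative 2 * u) (at u)"
      by (rule has_field_derivative_transform_within_open[of _ _ _ "{0<..}"]) (use 1 in auto)
    then show ?thesis using 1 by simp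
  next
    case 2
    have "((\<lambda>u::real. (max 0 u)\<^sup>2) has_real_derivative 0) (at u)"
      by (rule has_field_derivative_transform_within_open[of "\<lambda>u. 0" _ _ "{..<0}"]) (use 2 in auto)
    then show ?thesis using 2 by simp
  next
    case 3
    have "((\<lambda>h::real. (max 0 h)\<^sup>2 / h) \<longlongrightarrow> 0) (at 0)"
    proof (rule Lim_null_comparison)
      show "((\<lambda>h::real. \<bar>h\<bar>) \<longlongrightarrow> 0) (at 0)" using tendsto_rabs[OF tendsto_ident_at[of "0::real" UNIV]] by simp
      show "\<forall>\<^sub>F h::real in at 0. norm ((max 0 h)\<^sup>2 / h) \<le> \<bar>h\<bar>"
        by (rule always_eventually) (auto simp: max_def power2_eq_square)
    qed
    then show ?thesis by (simp add: 3 DERIV_def)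
  qed
qed

text \<open>The bump in one chart, seen through another: \<open>T\<close> is going to be a transition map.\<close>
lemma bump_compose_C1:
  fixes T :: "real^'n::finite \<Rightarrow> real^'n"
  assumes V: "hopen V" and T: "ck_on (Suc 0) V T"
  shows "ck_on (Suc 0) V (\<lambda>x. (max 0 (s - (T x - y) \<bullet> (T x - y)))\<^sup>2)"
proof -
  let ?u = "\<lambda>x. s - (T x - y) \<bullet> (T x - y)"
  have cT: "continuous_on V T" using T ck_on_imp_continuous_on by blast
  have cD: "continuous_on V (pd i T)" for i using ck_on_pd[OF V T] by simp
  show ?thesis
  proof (rule ck_on_SucI[OF V, where D = "\<lambda>x h. - (2 * ((T x - y) \<bullet> hderiv T x h)) * (2 * max 0 (?u x))"])
    fix x assume x: "x \<in> V"
    note d = ck_on_deriv[OF V T x]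
    have "(?u has_derivative (\<lambda>h. - (2 * ((T x - y) \<bullet> hderiv T x h)))) (at x within half_space)"
      by (auto intro!: derivative_eq_intros d simp: inner_commute)
    from DERIV_compose_FDERIV[OF DERIV_max_square this]
    show "((\<lambda>x. (max 0 (?u x))\<^sup>2) has_derivative
        (\<lambda>h. - (2 * ((T x - y) \<bullet> hderiv T x h)) * (2 * max 0 (?u x)))) (at x within half_space)" .
  next
    show "ck_on 0 V (\<lambda>x. - (2 * ((T x - y) \<bullet> hderiv T x (axis i 1))) * (2 * max 0 (?u x)))" for i
      unfolding pd_def[symmetric] ck_on.simps by (intro continuous_intros cT cD)
  qed
qed

context compact_riemannian
begin

lemma chart_sets: "a \<in> atlas M \<Longrightarrow> fst a \<in> sets borel" "a \<in> atlas M \<Longrightarrow> chart_image a \<in> sets borel"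
  using open_chart hopen_borel[OF hopen_image] by auto

lemma continuous_onI_charts:
  assumes "\<And>a. a \<in> atlas M \<Longrightarrow> continuous_on (chart_image a) (g \<circ> chart_inv a)"
  shows "continuous_on UNIV g"
proof (rule continuous_at_imp_continuous_on, intro ballI)
  fix p :: 'm
  define a where "a = chart_at M p"
  have a: "a \<in> atlas M" "p \<in> fst a" using chart_at by (auto simp: a_def)
  have s: "continuous_on (fst a) (snd a)" using chart_homeo[OF a(1)] by (simp add: homeomorphism_def)
  have "continuous_on (snd a ` fst a) (g \<circ> chart_inv a)"
    using assms[OF a(1)] by (simp add: chart_image_def)
  then have "continuous_on (fst a) ((g \<circ> chart_inv a) \<circ> snd a)"
    by (rule continuous_on_compose[OF s])
  moreover have "((g \<circ> chart_inv a) \<circ> snd a) q = g q" if "q \<in> fst a" for q using a(1) that by simp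
  ultimately have "continuous_on (fst a) g" by (simp cong: continuous_on_cong)
  then show "isCont g p" using open_chart[OF a(1)] a(2) by (simp add: continuous_on_eq_continuous_at)
qed

lemma chart_inv_continuous: "a \<in> atlas M \<Longrightarrow> continuous_on (chart_image a) (chart_inv a)"
  using chart_homeo[of a] by (simp add: homeomorphism_def)

lemma ck_fun_continuous: "ck_fun k f \<Longrightarrow> continuous_on UNIV f"
  by (rule continuous_onI_charts) (rule ck_on_imp_continuous_on[OF ck_funD])

lemma sets_vol [measurable_cong, simp]: "sets (vol M) = sets borel"
  using manifold by (simp add: riemannian_manifold_def riemannian_volume_def)

lemma space_vol [simp]: "space (vol M) = UNIV"
  using sets_eq_imp_space_eq[OF sets_vol] by simp

lemma emeasure_vol_chart:
  assumes "a \<in> atlas M" "B \<in> sets borel" "B \<subseteq> fst a"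
  shows "emeasure (vol M) B = (\<integral>\<^sup>+x\<in>snd a ` B. ennreal (vol_density M a x) \<partial>lborel)"
  using manifold assms by (auto simp: riemannian_manifold_def riemannian_volume_def)

definition chart_density :: "('m, 'n) chart \<Rightarrow> real^'n \<Rightarrow> real" where
  "chart_density a x = indicator (chart_image a) x * vol_density M a x"

lemma chart_density_measurable: "a \<in> atlas M \<Longrightarrow> chart_density a \<in> borel_measurable borel"
  using borel_measurable_continuous_on_indicator[OF chart_sets(2) ck_on_imp_continuous_on[OF vol_density_ck]]
  by (simp add: chart_density_def[abs_def])

lemma chart_density_nonneg: "a \<in> atlas M \<Longrightarrow> 0 \<le> chart_density a x"
  using vol_density_pos[of a x] by (auto simp: chart_density_def indicator_def)

text \<open>The volume measure restricted to the chart is the image, under the inverse chart, of Lebesgue measure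
  with the chart density, since both agree on Borel sets.\<close>
lemma chart_integral:
  assumes a: "a \<in> atlas M" and g: "(\<lambda>p. indicator (fst a) p * g p) \<in> borel_measurable borel"
  shows "(LINT p|vol M. indicator (fst a) p * g p) =
    (LINT x|lborel. chart_density a x * g (chart_inv a x))"
proof -
  define \<psi> where "\<psi> x = (if x \<in> chart_image a then chart_inv a x else undefined)" for x
  have \<psi>m: "\<psi> \<in> borel_measurable borel"
    unfolding \<psi>_def by (rule borel_measurable_continuous_on_if[OF chart_sets(2)[OF a] chart_inv_continuous[OF a]]) simp
  define I :: "'m \<Rightarrow> real" where "I = indicator (fst a)"
  have Im: "I \<in> borel_measurable borel" unfolding I_def using chart_sets(1)[OF a] by simp
  define D where "D = density lborel (\<lambda>x. ennreal (chart_density a x))"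
  have eq: "density (vol M) (\<lambda>p. ennreal (I p)) = distr D borel \<psi>"
  proof (rule measure_eqI)
    fix B assume "B \<in> sets (density (vol M) (\<lambda>p. ennreal (I p)))"
    then have B: "B \<in> sets borel" by simp
    have pre: "\<psi> -` B \<in> sets borel" using measurable_sets[OF \<psi>m B] by simp
    have BI: "B \<inter> fst a \<in> sets borel" using B chart_sets(1)[OF a] by auto
    have "emeasure (density (vol M) (\<lambda>p. ennreal (I p))) B = (\<integral>\<^sup>+p. ennreal (I p) * indicator B p \<partial>vol M)"
      using B Im by (intro emeasure_density) (auto intro: measurable_compose)
    also have "\<dots> = (\<integral>\<^sup>+p. indicator (B \<inter> fst a) p \<partial>vol M)"
      by (intro nn_integral_cong) (auto simp: I_def indicator_def)
    also have "\<dots> = emeasure (vol M) (B \<inter> fst a)" using BI by simp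
    also have "\<dots> = (\<integral>\<^sup>+x\<in>snd a ` (B \<inter> fst a). ennreal (vol_density M a x) \<partial>lborel)"
      using emeasure_vol_chart[OF a BI] by simp
    also have "\<dots> = (\<integral>\<^sup>+x. ennreal (chart_density a x) * indicator (\<psi> -` B) x \<partial>lborel)"
    proof (intro nn_integral_cong)
      fix x
      have "x \<in> snd a ` (B \<inter> fst a) \<longleftrightarrow> x \<in> chart_image a \<and> \<psi> x \<in> B"
        using a by (force simp: \<psi>_def image_iff)
      then show "ennreal (vol_density M a x) * indicator (snd a ` (B \<inter> fst a)) x =
          ennreal (chart_density a x) * indicator (\<psi> -` B) x"
        by (auto simp: chart_density_def indicator_def)
    qed
    also have "\<dots> = emeasure D (\<psi> -` B)"
      unfolding D_def using pre chart_density_measurable[OF a] by (intro emeasure_density[symmetric]) auto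
    also have "\<dots> = emeasure (distr D borel \<psi>) B"
      using B \<psi>m by (subst emeasure_distr) (auto simp: D_def)
    finally show "emeasure (density (vol M) (\<lambda>p. ennreal (I p))) B = emeasure (distr D borel \<psi>) B" .
  qed simp
  let ?g = "\<lambda>p. I p * g p"
  have gm: "?g \<in> borel_measurable borel" using g by (simp add: I_def)
  have "(LINT p|vol M. indicator (fst a) p * g p) = (LINT p|vol M. I p *\<^sub>R ?g p)"
    by (intro Bochner_Integration.integral_cong) (auto simp: I_def indicator_def)
  also have "\<dots> = (LINT p|density (vol M) (\<lambda>p. ennreal (I p)). ?g p)"
    using gm Im by (intro integral_density[symmetric])
      (auto simp: I_def measurable_cong_sets[OF sets_vol refl])
  also have "\<dots> = (LINT p|distr D borel \<psi>. ?g p)" by (simp only: eq)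
  also have "\<dots> = (LINT x|D. ?g (\<psi> x))"
    using \<psi>m gm by (intro integral_distr) (auto simp: D_def)
  also have "\<dots> = (LINT x|lborel. chart_density a x *\<^sub>R ?g (\<psi> x))"
    unfolding D_def
    using measurable_compose[OF \<psi>m gm] chart_density_measurable[OF a] chart_density_nonneg[OF a]
    by (intro integral_density) auto
  also have "\<dots> = (LINT x|lborel. chart_density a x * g (chart_inv a x))"
    using a by (intro Bochner_Integration.integral_cong)
      (auto simp: \<psi>_def I_def chart_density_def indicator_def)
  finally show ?thesis .
qed

definition bump_in :: "'m set \<Rightarrow> ('m \<Rightarrow> real) \<Rightarrow> bool" where
  "bump_in N \<psi> \<longleftrightarrow> ck_fun (Suc 0) \<psi> \<and> (\<forall>q. 0 \<le> \<psi> q) \<and>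
     (\<exists>K. compact K \<and> K \<subseteq> N \<and> (\<forall>q. q \<notin> K \<longrightarrow> \<psi> q = 0))"

text \<open>The bump is nonzero only in a coordinate ball whose closure in the half-space corresponds to a compact
  set \<open>K\<close> in \<open>N\<close>. In another chart it is \<open>C\<^sup>1\<close> on the overlap as a composition with the transition map,
  and zero off \<open>K\<close>, which is closed because the manifold is Hausdorff.\<close>
lemma bump_exists:
  assumes "open N" "p \<in> N"
  shows "\<exists>\<psi>. bump_in N \<psi> \<and> 0 < \<psi> p"
proof -
  define a where "a = chart_at M p"
  have a: "a \<in> atlas M" "p \<in> fst a" using chart_at by (auto simp: a_def)
  obtain r where r: "r > 0" "cball (snd a p) r \<inter> half_space \<subseteq> snd a ` (fst a \<inter> N)"
    using hopen_ball[OF hopen_chart[OF a(1) assms(1)], of "snd a p"] a assms(2) by auto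
  let ?C = "cball (snd a p) r \<inter> half_space"
  have C: "?C \<subseteq> chart_image a" using r by (auto simp: chart_image_def)
  define K where "K = chart_inv a ` ?C"
  have "compact ?C" by (intro compact_Int_closed compact_cball closed_half_space)
  then have K: "compact K"
    unfolding K_def by (intro compact_continuous_image continuous_on_subset[OF chart_inv_continuous[OF a(1)] C])
  then have clK: "closed K" by (rule compact_imp_closed)
  have KN: "K \<subseteq> fst a \<inter> N"
  proof
    fix q assume "q \<in> K"
    then obtain x where x: "x \<in> ?C" "q = chart_inv a x" by (auto simp: K_def)
    then obtain q' where "q' \<in> fst a" "q' \<in> N" "x = snd a q'" using r(2) by blast
    then show "q \<in> fst a \<inter> N" using x a(1) by simp
  qed
  define \<beta> where "\<beta> x = (max 0 (r\<^sup>2 - (x - snd a p) \<bullet> (x - snd a p)))\<^sup>2" for x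
  define \<psi> where "\<psi> q = (if q \<in> fst a then \<beta> (snd a q) else 0)" for q
  have off: "\<psi> q = 0" if q: "q \<notin> K" for q
  proof (cases "q \<in> fst a")
    case True
    have "snd a q \<notin> ?C"
    proof
      assume "snd a q \<in> ?C"
      then have "chart_inv a (snd a q) \<in> K" unfolding K_def by (rule imageI)
      then show False using q True a(1) by simp
    qed
    moreover have "snd a q \<in> half_space" using image_subset_half_space[OF a(1)] True by simp
    ultimately have "r < norm (snd a q - snd a p)" by (simp add: dist_norm norm_minus_commute)
    then have "r\<^sup>2 \<le> (norm (snd a q - snd a p))\<^sup>2" using r(1) by (intro power_mono) auto
    then show ?thesis using True by (simp add: \<psi>_def \<beta>_def dot_square_norm)
  qed (simp add: \<psi>_def)
  have ck: "ck_fun (Suc 0) \<psi>"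
    unfolding ck_fun_def
  proof (intro ballI, rule ck_on_local)
    fix b assume b: "b \<in> atlas M"
    show "hopen (chart_image b)" using hopen_image[OF b] .
    fix x assume x: "x \<in> chart_image b"
    define q where "q = chart_inv b x"
    have q: "q \<in> fst b" "x = snd b q" using x b by (auto simp: q_def)
    show "\<exists>V. hopen V \<and> x \<in> V \<and> V \<subseteq> chart_image b \<and> ck_on (Suc 0) V (\<psi> \<circ> chart_inv b)"
    proof (cases "q \<in> fst a")
      case True
      let ?V = "snd b ` (fst b \<inter> fst a)"
      have V: "hopen ?V" by (rule hopen_overlap[OF b a(1)])
      have "ck_on (Suc 0) ?V (\<lambda>x. \<beta> ((snd a \<circ> chart_inv b) x))"
        unfolding \<beta>_def by (rule bump_compose_C1[OF V transition_ck[OF b a(1)]])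
      then have "ck_on (Suc 0) ?V (\<psi> \<circ> chart_inv b)"
      proof (rule iffD2[OF ck_on_cong[OF V], rotated])
        fix y assume "y \<in> ?V"
        then obtain q where "q \<in> fst b" "q \<in> fst a" "y = snd b q" by blast
        then show "(\<psi> \<circ> chart_inv b) y = \<beta> ((snd a \<circ> chart_inv b) y)"
          using b by (simp add: \<psi>_def)
      qed
      moreover have "x \<in> ?V" "?V \<subseteq> chart_image b" using q True by (auto simp: chart_image_def)
      ultimately show ?thesis using V by blast
    next
      case False
      let ?V = "snd b ` (fst b \<inter> - K)"
      have V: "hopen ?V" using hopen_chart[OF b] clK by (simp add: open_Compl)
      from ck_on_const[OF V, of "Suc 0" "0 :: real"]
      have "ck_on (Suc 0) ?V (\<psi> \<circ> chart_inv b)"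
      proof (rule iffD2[OF ck_on_cong[OF V], rotated])
        fix y assume "y \<in> ?V"
        then obtain q where "q \<in> fst b" "q \<notin> K" "y = snd b q" by blast
        then show "(\<psi> \<circ> chart_inv b) y = 0" using b off by simp
      qed
      moreover have "x \<in> ?V" "?V \<subseteq> chart_image b" using q False KN by (auto simp: chart_image_def)
      ultimately show ?thesis using V by blast
    qed
  qed
  have "0 \<le> \<psi> q" for q by (simp add: \<psi>_def \<beta>_def)
  then have "bump_in N \<psi>" using ck K KN off by (auto simp: bump_in_def)
  moreover have "0 < \<psi> p" using a r(1) by (simp add: \<psi>_def \<beta>_def)
  ultimately show ?thesis by blast
qed

lemma emeasure_compact_chart_finite:
  assumes a: "a \<in> atlas M" and K: "compact K" "K \<subseteq> fst a"
  shows "emeasure (vol M) K < \<infinity>"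
proof -
  have cs: "continuous_on K (snd a)"
    using chart_homeo[OF a] K(2) continuous_on_subset by (auto simp: homeomorphism_def)
  have C: "compact (snd a ` K)" by (rule compact_continuous_image[OF cs K(1)])
  have sub: "snd a ` K \<subseteq> chart_image a" using K(2) by (auto simp: chart_image_def)
  have "continuous_on (snd a ` K) (vol_density M a)"
    by (rule continuous_on_subset[OF ck_on_imp_continuous_on[OF vol_density_ck[OF a]] sub])
  then have i: "integrable lborel (\<lambda>x. indicator (snd a ` K) x *\<^sub>R vol_density M a x)"
    by (rule borel_integrable_compact[OF C])
  have "emeasure (vol M) K = (\<integral>\<^sup>+x. ennreal (vol_density M a x) * indicator (snd a ` K) x \<partial>lborel)"
    using emeasure_vol_chart[OF a borel_compact[OF K(1)] K(2)] .
  also have "\<dots> = (\<integral>\<^sup>+x. ennreal (norm (indicator (snd a ` K) x *\<^sub>R vol_density M a x)) \<partial>lborel)"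
    by (intro nn_integral_cong) (use vol_density_pos[OF a] sub in \<open>auto simp: indicator_def less_imp_le\<close>)
  also have "\<dots> < \<infinity>" using i by (simp add: integrable_iff_bounded)
  finally show ?thesis .
qed

lemma finite_bump_cover:
  obtains I :: "('m \<Rightarrow> real) set" where "finite I"
    "\<And>\<psi>. \<psi> \<in> I \<Longrightarrow> \<exists>a\<in>atlas M. bump_in (fst a) \<psi>" "\<And>q. 0 < (\<Sum>\<psi>\<in>I. \<psi> q)"
proof -
  define \<B> where "\<B> = {\<psi>. \<exists>a\<in>atlas M. bump_in (fst a) \<psi>}"
  have op: "open {q. 0 < \<psi> q}" if "\<psi> \<in> \<B>" for \<psi>
  proof -
    have "continuous_on UNIV \<psi>" using that ck_fun_continuous by (auto simp: \<B>_def bump_in_def)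
    then show ?thesis by (intro open_Collect_less continuous_on_const)
  qed
  have "\<exists>\<psi>\<in>\<B>. 0 < \<psi> p" for p
    using bump_exists[OF open_chart[OF chart_at(1)] chart_at(2)[of p]] chart_at(1)[of p]
    unfolding \<B>_def by blast
  then have "UNIV \<subseteq> (\<Union>\<psi>\<in>\<B>. {q. 0 < \<psi> q})" by blast
  from compactE_image[OF compact op this]
  obtain I where I: "I \<subseteq> \<B>" "finite I" "UNIV \<subseteq> (\<Union>\<psi>\<in>I. {q. 0 < \<psi> q})" by blast
  have "0 < (\<Sum>\<psi>\<in>I. \<psi> q)" for q
  proof -
    obtain \<psi> where "\<psi> \<in> I" "0 < \<psi> q" using I(3) by blast
    then show ?thesis using I(1,2) by (intro sum_pos2) (auto simp: \<B>_def bump_in_def)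
  qed
  then show ?thesis using I(1,2) by (intro that[of I]) (auto simp: \<B>_def)
qed

lemma finite_vol: "finite_measure (vol M)"
proof
  obtain I :: "('m \<Rightarrow> real) set" where I: "finite I"
    "\<And>\<psi>. \<psi> \<in> I \<Longrightarrow> \<exists>a\<in>atlas M. bump_in (fst a) \<psi>" "\<And>q. 0 < (\<Sum>\<psi>\<in>I. \<psi> q)"
    using finite_bump_cover by blast
  then obtain K where K: "\<And>\<psi>. \<psi> \<in> I \<Longrightarrow>
      compact (K \<psi>) \<and> (\<exists>a\<in>atlas M. K \<psi> \<subseteq> fst a) \<and> (\<forall>q. q \<notin> K \<psi> \<longrightarrow> \<psi> q = 0)"
    unfolding bump_in_def by metis
  have "UNIV \<subseteq> (\<Union>\<psi>\<in>I. K \<psi>)"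
  proof
    fix q
    have "\<exists>\<psi>\<in>I. \<psi> q \<noteq> 0" using I(3)[of q] by (metis less_irrefl sum.neutral)
    then show "q \<in> (\<Union>\<psi>\<in>I. K \<psi>)" using K by blast
  qed
  then have "emeasure (vol M) UNIV \<le> emeasure (vol M) (\<Union>\<psi>\<in>I. K \<psi>)"
    using I(1) K by (intro emeasure_mono) (auto intro!: sets.finite_UN borel_compact)
  also have "\<dots> \<le> (\<Sum>\<psi>\<in>I. emeasure (vol M) (K \<psi>))"
    using I(1) K by (intro emeasure_subadditive_finite) (auto intro!: borel_compact)
  also have "\<dots> < \<infinity>"
  proof -
    have "emeasure (vol M) (K \<psi>) < \<infinity>" if "\<psi> \<in> I" for \<psi>
      using K[OF that] emeasure_compact_chart_finite by blast
    then show ?thesis using I(1) by (simp add: less_top)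
  qed
  finally show "emeasure (vol M) (space (vol M)) \<noteq> \<infinity>" by simp
qed

lemma continuous_measurable:
  fixes g :: "'m \<Rightarrow> real"
  shows "continuous_on UNIV g \<Longrightarrow> g \<in> borel_measurable (vol M)"
  using borel_measurable_continuous_onI measurable_cong_sets[OF sets_vol refl] by blast

lemma integrable_continuous:
  fixes g :: "'m \<Rightarrow> real"
  assumes "continuous_on UNIV g"
  shows "integrable (vol M) g"
proof -
  have "bounded (range g)" using compact_continuous_image[OF assms compact] compact_imp_bounded by blast
  then obtain B where "\<And>p. norm (g p) \<le> B" by (auto simp: bounded_iff)
  then show ?thesis
    by (intro finite_measure.integrable_const_bound[OF finite_vol _ continuous_measurable[OF assms]]) auto
qed

text \<open>A nonempty open set has positive volume: its image in a chart contains a ball, and the volume density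
  is positive. The ball is centred off the bounding hyperplane, as the given point may lie on it.\<close>
lemma integral_zero_imp_zero:
  fixes g :: "'m \<Rightarrow> real"
  assumes g: "continuous_on UNIV g" "\<And>p. 0 \<le> g p" and zero: "(LINT p|vol M. g p) = 0"
  shows "g p = 0"
proof (rule ccontr)
  assume "g p \<noteq> 0"
  define a where "a = chart_at M p"
  have a: "a \<in> atlas M" "p \<in> fst a" using chart_at by (auto simp: a_def)
  have "AE q in vol M. g q = 0"
    using integral_nonneg_eq_0_iff_AE[OF integrable_continuous[OF g(1)]] g(2) zero by auto
  define N where "N = {q. g q \<noteq> 0}"
  have N: "open N" unfolding N_def
    by (rule open_Collect_neq[OF g(1)]) simp
  have Nb: "N \<inter> fst a \<in> sets borel" using N open_chart[OF a(1)] by auto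
  have "emeasure (vol M) N = 0"
    using \<open>AE q in vol M. g q = 0\<close> N AE_iff_measurable[of N "vol M" "\<lambda>q. g q = 0"] by (simp add: N_def)
  then have "emeasure (vol M) (N \<inter> fst a) = 0"
    using emeasure_mono[of "N \<inter> fst a" N "vol M"] N by simp
  then have z: "(\<integral>\<^sup>+x\<in>snd a ` (N \<inter> fst a). ennreal (vol_density M a x) \<partial>lborel) = 0"
    using emeasure_vol_chart[OF a(1) Nb] by simp
  let ?V = "snd a ` (fst a \<inter> N)"
  have V: "hopen ?V" by (rule hopen_chart[OF a(1) N])
  have Vim: "?V \<subseteq> chart_image a" by (auto simp: chart_image_def)
  have "(\<integral>\<^sup>+x. ennreal (chart_density a x * indicator ?V x) \<partial>lborel) = 0"
    using z Vim by (subst (asm) nn_integral_cong[where v = "\<lambda>x. ennreal (chart_density a x * indicator ?V x)"])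
      (auto simp: chart_density_def indicator_def Int_commute)
  then have "AE x in lborel. ennreal (chart_density a x * indicator ?V x) = 0"
    using chart_density_measurable[OF a(1)] hopen_borel[OF V] by (subst (asm) nn_integral_0_iff_AE) auto
  then have "AE x in lborel. x \<notin> ?V"
  proof (rule AE_mp, intro AE_I2 impI notI)
    fix x assume x: "ennreal (chart_density a x * indicator ?V x) = 0" "x \<in> ?V"
    then have "x \<in> chart_image a" using Vim by blast
    then show False using x vol_density_pos[OF a(1), of x] by (simp add: chart_density_def ennreal_eq_0_iff)
  qed
  then have null: "emeasure lborel ?V = 0"
    using AE_iff_measurable[of ?V lborel "\<lambda>x. x \<notin> ?V"] hopen_borel[OF V] by simp
  have "snd a p \<in> ?V" using a \<open>g p \<noteq> 0\<close> by (auto simp: N_def)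
  then obtain r where r: "r > 0" "cball (snd a p) r \<inter> half_space \<subseteq> ?V" using hopen_ball[OF V] by blast
  define y where "y = snd a p + (r/2) *\<^sub>R axis bdry_coord 1"
  have "ball y (r/2) \<subseteq> cball (snd a p) r \<inter> half_space"
  proof
    fix z assume z: "z \<in> ball y (r/2)"
    have "dist (snd a p) y = r/2" using r(1) by (simp add: y_def dist_norm)
    then have d: "dist (snd a p) z \<le> r" using z dist_triangle[of "snd a p" z y] by simp
    have "\<bar>(y - z) $ bdry_coord\<bar> < r/2"
      using z component_le_norm_cart[of "y - z" bdry_coord] by (simp add: dist_norm)
    then have "(y - z) $ bdry_coord < r/2" by linarith
    moreover have "0 \<le> snd a p $ bdry_coord"
      using image_subset_half_space[OF a(1) chart_in_image[OF a(2)]] by (simp add: half_space_def)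
    ultimately show "z \<in> cball (snd a p) r \<inter> half_space"
      using d by (simp add: half_space_def y_def)
  qed
  then have "ball y (r/2) \<subseteq> ?V" using r(2) by blast
  then have "emeasure lborel (ball y (r/2)) = 0"
    using emeasure_mono[of "ball y (r/2)" ?V lborel] null hopen_borel[OF V] by simp
  then have "measure lborel (ball y (r/2)) = 0" by (simp add: measure_def)
  then show False using r(1) by simp
qed

end

section \<open>The divergence theorem on the manifold\<close>

lemma pd_mult:
  fixes f g :: "real^'n::finite \<Rightarrow> real"
  assumes "hopen U" "ck_on (Suc k) U f" "ck_on (Suc l) U g" "x \<in> U"
  shows "pd i (\<lambda>y. f y * g y) x = f x * pd i g x + pd i f x * g x"
proof -
  have "((\<lambda>y. f y * g y) has_derivative (\<lambda>h. f x * hderiv g x h + hderiv f x h * g x)) (at x within half_space)"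
    by (intro has_derivative_mult ck_on_deriv[OF assms(1,2,4)] ck_on_deriv[OF assms(1,3,4)])
  from pd_eq[OF this subsetD[OF hopen_subset[OF assms(1)] assms(4)]] show ?thesis by (simp add: pd_def)
qed

context compact_riemannian
begin

lemma ck_fun_const: "ck_fun k (\<lambda>_. r)"
  unfolding ck_fun_def o_def by (intro ballI ck_on_const hopen_image)

lemma ck_fun_add: "ck_fun k f \<Longrightarrow> ck_fun k g \<Longrightarrow> ck_fun k (\<lambda>p. f p + g p)"
  using ck_on_add[OF hopen_image] unfolding ck_fun_def o_def by blast

lemma ck_fun_mult: "ck_fun k f \<Longrightarrow> ck_fun k g \<Longrightarrow> ck_fun k (\<lambda>p. f p * g p)"
  using ck_on_mult[OF hopen_image] unfolding ck_fun_def o_def by blast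

lemma ck_fun_minus: "ck_fun k f \<Longrightarrow> ck_fun k (\<lambda>p. - f p)"
  using ck_on_minus[OF hopen_image] unfolding ck_fun_def o_def by blast

lemma ck_fun_sum: "(\<And>i. i \<in> I \<Longrightarrow> ck_fun k (f i)) \<Longrightarrow> ck_fun k (\<lambda>p. \<Sum>i\<in>I. f i p)"
  unfolding ck_fun_def o_def by (intro ballI ck_on_sum hopen_image) auto

lemma ck_fun_inverse: "ck_fun k f \<Longrightarrow> (\<And>p. f p \<noteq> 0) \<Longrightarrow> ck_fun k (\<lambda>p. inverse (f p))"
  unfolding ck_fun_def o_def by (intro ballI ck_on_inverse hopen_image) auto

lemma dfun_eqI:
  assumes "((f \<circ> chart_inv (chart_at M p)) has_derivative D) (at (snd (chart_at M p) p) within half_space)"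
  shows "dfun M f p = D"
  unfolding dfun_chart_at
  by (rule hderiv_unique[OF assms image_subset_half_space[OF chart_at(1) chart_in_image[OF chart_at(2)]]])

lemma dfun_deriv:
  assumes "ck_fun (Suc k) f"
  shows "((f \<circ> chart_inv (chart_at M p)) has_derivative dfun M f p) (at (snd (chart_at M p) p) within half_space)"
  unfolding dfun_chart_at by (rule ck_fun_deriv[OF assms chart_at(1) chart_in_image[OF chart_at(2)]])

lemma dfun_sum:
  assumes "\<And>i. i \<in> I \<Longrightarrow> ck_fun (Suc k) (f i)"
  shows "dfun M (\<lambda>p. \<Sum>i\<in>I. f i p) p u = (\<Sum>i\<in>I. dfun M (f i) p u)"
proof -
  have "dfun M (\<lambda>p. \<Sum>i\<in>I. f i p) p = (\<lambda>u. \<Sum>i\<in>I. dfun M (f i) p u)"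
    using has_derivative_sum[of I "\<lambda>i. f i \<circ> chart_inv (chart_at M p)" "\<lambda>i. dfun M (f i) p"] dfun_deriv[OF assms]
    by (intro dfun_eqI) (simp add: o_def)
  then show ?thesis by simp
qed

text \<open>Locality of the differential: it lets pieces with compact support in a chart be extended by zero.\<close>
lemma dfun_zero:
  assumes "open N" "p \<in> N" "\<And>q. q \<in> N \<Longrightarrow> f q = 0"
  shows "dfun M f p u = 0"
proof -
  let ?a = "chart_at M p"
  have V: "hopen (snd ?a ` (fst ?a \<inter> N))" "snd ?a p \<in> snd ?a ` (fst ?a \<inter> N)"
    using hopen_chart[OF chart_at(1) assms(1)] chart_at(2) assms(2) by auto
  have "((\<lambda>_. 0) has_derivative (\<lambda>_. 0)) (at (snd ?a p) within half_space)" by simp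
  then have "((f \<circ> chart_inv ?a) has_derivative (\<lambda>_. 0)) (at (snd ?a p) within half_space)"
  proof (rule iffD2[OF has_hderiv_cong[OF V], rotated])
    fix y assume "y \<in> snd ?a ` (fst ?a \<inter> N)"
    then obtain q where "q \<in> fst ?a" "q \<in> N" "y = snd ?a q" by blast
    then show "(f \<circ> chart_inv ?a) y = 0" using assms(3) chart_inv_chart[OF chart_at(1)] by simp
  qed
  from dfun_eqI[OF this] show ?thesis by simp
qed

lemma dfun_pairing_continuous:
  assumes "ck_fun (Suc k) f" "smooth_field M w"
  shows "continuous_on UNIV (\<lambda>p. dfun M f p (w p))"
proof (rule continuous_onI_charts)
  fix a assume a: "a \<in> atlas M"
  have "continuous_on (chart_image a) (\<lambda>x. \<Sum>i\<in>UNIV. coord_field M a w x $ i * pd i (f \<circ> chart_inv a) x)"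
    by (intro continuous_intros ck_on_imp_continuous_on[OF smooth_field_comp[OF assms(2) a]]
        ck_on_imp_continuous_on[OF ck_on_pd[OF hopen_image[OF a] ck_funD[OF assms(1) a]]])
  then show "continuous_on (chart_image a) ((\<lambda>p. dfun M f p (w p)) \<circ> chart_inv a)"
    by (simp add: dfun_coord[OF assms(1) a] cong: continuous_on_cong)
qed

subsection \<open>Divergence in a chart\<close>

lemma flux_ck:
  assumes "smooth_field M w" "a \<in> atlas M"
  shows "ck_on k (chart_image a) (\<lambda>y. vol_density M a y * coord_field M a w y $ i)"
  by (rule ck_on_mult[OF hopen_image[OF assms(2)] vol_density_ck[OF assms(2)] smooth_field_comp[OF assms]])

lemma coord_div_eq:
  assumes "a \<in> atlas M" "x \<in> chart_image a"
  shows "coord_div M a w x =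
    (\<Sum>i\<in>UNIV. pd i (\<lambda>y. vol_density M a y * coord_field M a w y $ i) x) * inverse (vol_density M a x)"
  unfolding coord_div_def pd_def hopen_at_within[OF hopen_image[OF assms(1)] assms(2)] divide_inverse ..

lemma coord_div_ck:
  assumes w: "smooth_field M w" and a: "a \<in> atlas M"
  shows "ck_on k (chart_image a) (coord_div M a w)"
proof -
  note U = hopen_image[OF a]
  have "ck_on k (chart_image a) (\<lambda>x. (\<Sum>i\<in>UNIV. pd i (\<lambda>y. vol_density M a y * coord_field M a w y $ i) x)
      * inverse (vol_density M a x))"
    by (intro ck_on_mult[OF U] ck_on_sum[OF U] ck_on_pd[OF U flux_ck[OF w a]]
        ck_on_inverse[OF U _ vol_density_ck[OF a]]) (use vol_density_pos[OF a] in force)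
  then show ?thesis using ck_on_cong[OF U coord_div_eq[OF a], where k = k] by simp
qed

text \<open>With \<open>\<rho>\<close> the volume density and \<open>X = \<rho> w\<close>, \<open>\<rho>\<close> times the integrand is \<open>\<Sum>\<^sub>i \<partial>\<^sub>i (f X\<^sub>i)\<close> in the
  chart, where \<open>f X\<close> has compact support and its normal component vanishes on the boundary.\<close>
lemma chart_integration_by_parts:
  assumes w: "w \<in> tangential_fields M" and a: "a \<in> atlas M" and f: "ck_fun (Suc 0) f"
    and K: "compact K" "K \<subseteq> fst a" and off: "\<And>q. q \<notin> K \<Longrightarrow> f q = 0"
  defines "g \<equiv> \<lambda>p. indicator (fst a) p * (f p * coord_div M a w (snd a p) + dfun M f p (w p))"
  shows "continuous_on UNIV g" "(LINT p|vol M. g p) = 0"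
proof -
  let ?U = "chart_image a"
  note U = hopen_image[OF a]
  have ws: "smooth_field M w" using w by (simp add: tangential_fields_def)
  have clK: "closed K" using K(1) by (rule compact_imp_closed)
  let ?g = "\<lambda>p. f p * coord_div M a w (snd a p) + dfun M f p (w p)"
  have g0: "?g p = 0" if "p \<notin> K" for p
    using off[OF that] dfun_zero[of "- K" p f] clK that off by (simp add: open_Compl)
  have gc: "continuous_on (fst a) ?g"
  proof (intro continuous_intros)
    show "continuous_on (fst a) f" using ck_fun_continuous[OF f] by (rule continuous_on_subset) simp
    show "continuous_on (fst a) (\<lambda>p. dfun M f p (w p))"
      using dfun_pairing_continuous[OF f ws] by (rule continuous_on_subset) simp
    have s: "continuous_on (fst a) (snd a)" using chart_homeo[OF a] by (simp add: homeomorphism_def)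
    show "continuous_on (fst a) (\<lambda>p. coord_div M a w (snd a p))"
      by (rule continuous_on_compose2[OF ck_on_imp_continuous_on[OF coord_div_ck[OF ws a]] s]) auto
  qed
  show "continuous_on UNIV g"
  proof -
    have "continuous_on (fst a) g"
      using gc by (rule continuous_on_eq) (simp add: g_def)
    moreover have "continuous_on (- K) g"
      using continuous_on_const by (rule continuous_on_eq[where f = "\<lambda>_. 0"]) (use g0 in \<open>simp add: g_def\<close>)
    ultimately have "continuous_on (fst a \<union> - K) g"
      using open_chart[OF a] clK by (intro continuous_on_open_Un) (auto simp: open_Compl)
    moreover have "fst a \<union> - K = UNIV" using K(2) by blast
    ultimately show ?thesis by simp
  qed
  define fa where "fa = f \<circ> chart_inv a"
  have fa: "ck_on (Suc 0) ?U fa" unfolding fa_def by (rule ck_funD[OF f a])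
  define X where "X i y = vol_density M a y * coord_field M a w y $ i" for i y
  have X: "ck_on k ?U (X i)" for k i unfolding X_def by (rule flux_ck[OF ws a])
  have comp: "compact (snd a ` K)"
    using chart_homeo[OF a] K continuous_on_subset by (intro compact_continuous_image) (auto simp: homeomorphism_def)
  have sub: "snd a ` K \<subseteq> ?U" using K(2) by (auto simp: chart_image_def)
  have fa0: "fa x = 0" if "x \<in> ?U" "x \<notin> snd a ` K" for x
  proof -
    have "chart_inv a x \<notin> K" using that chart_chart_inv[OF a that(1)] by force
    then show ?thesis by (simp add: fa_def off)
  qed
  have bd: "fa x * X i x = 0" if "i = bdry_coord" "x \<in> ?U" "x $ bdry_coord = 0" for i x
    using tangential_boundary[OF w a that(2,3)] that(1) by (simp add: X_def)
  have i: "integrable lborel (\<lambda>x. indicator ?U x * pd i (\<lambda>x. fa x * X i x) x)"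
    and z: "(LINT x|lborel. indicator ?U x * pd i (\<lambda>x. fa x * X i x) x) = 0" for i
    using half_space_integral_pd[OF U comp sub ck_on_mult[OF U fa X], of i] fa0 bd by auto
  have "(LINT p|vol M. g p) = (LINT x|lborel. chart_density a x * ?g (chart_inv a x))"
    unfolding g_def
  proof (rule chart_integral[OF a])
    show "(\<lambda>p. indicator (fst a) p * ?g p) \<in> borel_measurable borel"
      using borel_measurable_continuous_on_indicator[OF chart_sets(1)[OF a] gc] by simp
  qed
  also have "\<dots> = (LINT x|lborel. (\<Sum>i\<in>UNIV. indicator ?U x * pd i (\<lambda>x. fa x * X i x) x))"
  proof (intro Bochner_Integration.integral_cong refl)
    fix x
    show "chart_density a x * ?g (chart_inv a x) = (\<Sum>i\<in>UNIV. indicator ?U x * pd i (\<lambda>x. fa x * X i x) x)"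
    proof (cases "x \<in> ?U")
      case True
      let ?\<rho> = "vol_density M a x"
      have \<rho>: "?\<rho> > 0" by (rule vol_density_pos[OF a True])
      define S where "S = (\<Sum>i\<in>UNIV. pd i (X i) x)"
      define R where "R = (\<Sum>i\<in>UNIV. coord_field M a w x $ i * pd i fa x)"
      have "?g (chart_inv a x) = fa x * (S * inverse ?\<rho>) + R"
        using a True dfun_coord[OF f a True] coord_div_eq[OF a True]
        by (simp add: fa_def S_def R_def X_def[abs_def])
      then have "?\<rho> * ?g (chart_inv a x) = fa x * S + ?\<rho> * R"
        using \<rho> by (simp add: field_simps)
      also have "\<dots> = (\<Sum>i\<in>UNIV. fa x * pd i (X i) x + pd i fa x * X i x)"
        by (simp add: S_def R_def sum.distrib sum_distrib_left X_def mult_ac)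
      also have "\<dots> = (\<Sum>i\<in>UNIV. pd i (\<lambda>x. fa x * X i x) x)"
        using pd_mult[OF U fa X[where k = "Suc 0"] True] by simp
      finally show ?thesis using True by (simp add: chart_density_def)
    qed (simp add: chart_density_def)
  qed
  also have "\<dots> = 0" by (subst Bochner_Integration.integral_sum) (use i z in simp_all)
  finally show "(LINT p|vol M. g p) = 0" .
qed

text \<open>The term \<open>df(w)\<close> in the local integration by parts does not depend on the chart, so the difference of
  the two divergences integrates to zero against every bump supported in both charts. Where the difference
  is positive, such a bump gives a contradiction. The inequality suffices since the charts can be
  exchanged. Bumps may charge the boundary because \<open>w\<close> is tangential, so boundary points are included.\<close>
lemma coord_div_le:
  assumes w: "w \<in> tangential_fields M" and a: "a \<in> atlas M" "p \<in> fst a" and b: "b \<in> atlas M" "p \<in> fst b"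
  shows "coord_div M a w (snd a p) \<le> coord_div M b w (snd b p)"
proof (rule ccontr)
  assume contr: "\<not> ?thesis"
  have ws: "smooth_field M w" using w by (simp add: tangential_fields_def)
  have c: "continuous_on (fst d) (\<lambda>p. coord_div M d w (snd d p))" if d: "d \<in> atlas M" for d
  proof -
    have s: "continuous_on (fst d) (snd d)" using chart_homeo[OF d] by (simp add: homeomorphism_def)
    show ?thesis
      by (rule continuous_on_compose2[OF ck_on_imp_continuous_on[OF coord_div_ck[OF ws d]] s]) auto
  qed
  define D where "D q = coord_div M a w (snd a q) - coord_div M b w (snd b q)" for q
  have Dp: "0 < D p" using contr by (simp add: D_def)
  define N where "N = (fst a \<inter> fst b) \<inter> D -` {0<..}"
  have "continuous_on (fst a \<inter> fst b) D"
    unfolding D_def by (intro continuous_intros continuous_on_subset[OF c[OF a(1)]] continuous_on_subset[OF c[OF b(1)]]) auto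
  then have N: "open N"
    unfolding N_def using open_chart[OF a(1)] open_chart[OF b(1)]
    by (intro continuous_open_preimage) auto
  have "p \<in> N" using a b Dp by (simp add: N_def)
  then obtain \<psi> where \<psi>: "bump_in N \<psi>" "0 < \<psi> p" using bump_exists[OF N] by blast
  then obtain K where K: "compact K" "K \<subseteq> N" "\<And>q. q \<notin> K \<Longrightarrow> \<psi> q = 0"
    and ck: "ck_fun (Suc 0) \<psi>" and pos: "\<And>q. 0 \<le> \<psi> q" by (auto simp: bump_in_def)
  define g where "g d q = indicator (fst d) q * (\<psi> q * coord_div M d w (snd d q) + dfun M \<psi> q (w q))" for d q
  have Ka: "K \<subseteq> fst a" and Kb: "K \<subseteq> fst b" using K(2) by (auto simp: N_def)
  note ga = chart_integration_by_parts[OF w a(1) ck K(1) Ka K(3), folded g_def]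
  note gb = chart_integration_by_parts[OF w b(1) ck K(1) Kb K(3), folded g_def]
  have diff: "g a q - g b q = \<psi> q * D q * indicator K q" for q
  proof (cases "q \<in> K")
    case True
    then have "q \<in> fst a" "q \<in> fst b" using Ka Kb by auto
    then show ?thesis using True by (simp add: g_def D_def algebra_simps)
  next
    case False
    have "dfun M \<psi> q (w q) = 0"
      using dfun_zero[of "- K" q \<psi>] K False compact_imp_closed[OF K(1)] by (simp add: open_Compl)
    then show ?thesis using K(3)[OF False] False by (simp add: g_def)
  qed
  have "g a p - g b p = 0"
  proof (rule integral_zero_imp_zero[where g = "\<lambda>q. g a q - g b q"])
    show "continuous_on UNIV (\<lambda>q. g a q - g b q)" using ga(1) gb(1) by (intro continuous_intros)
    show "0 \<le> g a q - g b q" for q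
    proof (cases "q \<in> K")
      case True
      then have "0 < D q" using K(2) by (auto simp: N_def)
      then show ?thesis using pos[of q] by (simp add: diff)
    qed (simp add: diff)
    show "(LINT q|vol M. g a q - g b q) = 0"
      using ga gb by (simp add: integrable_continuous)
  qed
  moreover have "p \<in> K" using K(3) \<psi>(2) by force
  ultimately show False using Dp \<psi>(2) by (simp add: diff)
qed

lemma dvg_chart:
  assumes "w \<in> tangential_fields M" "a \<in> atlas M" "p \<in> fst a"
  shows "dvg M w p = coord_div M a w (snd a p)"
  unfolding dvg_def by (intro antisym coord_div_le assms chart_at)

lemma dvg_smooth:
  assumes w: "w \<in> tangential_fields M"
  shows "smooth_fun M (dvg M w)"
  unfolding smooth_fun_iff ck_fun_def
proof (intro allI ballI)
  fix k a assume a: "a \<in> atlas M"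
  have ws: "smooth_field M w" using w by (simp add: tangential_fields_def)
  have "(dvg M w \<circ> chart_inv a) x = coord_div M a w x" if "x \<in> chart_image a" for x
    using dvg_chart[OF w a] a that by simp
  from iffD2[OF ck_on_cong[OF hopen_image[OF a] this] coord_div_ck[OF ws a]]
  show "ck_on k (chart_image a) (dvg M w \<circ> chart_inv a)" by blast
qed

text \<open>Decompose \<open>f\<close> with the normalized bumps of a finite cover and apply the local statement to each piece; the
  pieces add up to \<open>f\<close>, and their differentials to that of \<open>f\<close>.\<close>
theorem integration_by_parts:
  assumes w: "w \<in> tangential_fields M" and f: "ck_fun (Suc 0) f"
  shows "(LINT p|vol M. f p * dvg M w p) = - (LINT p|vol M. dfun M f p (w p))"
proof -
  have ws: "smooth_field M w" using w by (simp add: tangential_fields_def)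
  have dc: "continuous_on UNIV (dvg M w)"
    using dvg_smooth[OF w] ck_fun_continuous by (auto simp: smooth_fun_iff)
  obtain I :: "('m \<Rightarrow> real) set" where I: "finite I"
    "\<And>\<psi>. \<psi> \<in> I \<Longrightarrow> \<exists>a\<in>atlas M. bump_in (fst a) \<psi>" "\<And>q. 0 < (\<Sum>\<psi>\<in>I. \<psi> q)"
    using finite_bump_cover by blast
  define \<Psi> where "\<Psi> q = (\<Sum>\<psi>\<in>I. \<psi> q)" for q
  have \<psi>: "ck_fun (Suc 0) \<psi>" if "\<psi> \<in> I" for \<psi> using I(2)[OF that] by (auto simp: bump_in_def)
  have \<Psi>: "ck_fun (Suc 0) (\<lambda>q. inverse (\<Psi> q))"
    unfolding \<Psi>_def using I(3) \<psi> by (intro ck_fun_inverse ck_fun_sum) (auto simp: less_imp_neq[symmetric])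
  define h where "h \<psi> q = \<psi> q * (f q * inverse (\<Psi> q))" for \<psi> q
  have h: "ck_fun (Suc 0) (h \<psi>)" if "\<psi> \<in> I" for \<psi>
    unfolding h_def by (intro ck_fun_mult \<psi>[OF that] f \<Psi>)
  have sum_h: "(\<Sum>\<psi>\<in>I. h \<psi> q) = f q" for q
  proof -
    have "(\<Sum>\<psi>\<in>I. h \<psi> q) = \<Psi> q * (f q * inverse (\<Psi> q))"
      unfolding h_def \<Psi>_def by (simp add: sum_distrib_right)
    then show ?thesis using I(3)[of q] by (simp add: \<Psi>_def)
  qed
  have cont: "continuous_on UNIV (\<lambda>p. h \<psi> p * dvg M w p)"
      "continuous_on UNIV (\<lambda>p. dfun M (h \<psi>) p (w p))" if "\<psi> \<in> I" for \<psi>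
    using dfun_pairing_continuous[OF h[OF that] ws] ck_fun_continuous[OF h[OF that]] dc
    by (auto intro: continuous_on_mult)
  have zero: "(LINT p|vol M. h \<psi> p * dvg M w p + dfun M (h \<psi>) p (w p)) = 0" if mem: "\<psi> \<in> I" for \<psi>
  proof -
    obtain a where a: "a \<in> atlas M" "bump_in (fst a) \<psi>" using I(2) mem by blast
    then obtain K where K: "compact K" "K \<subseteq> fst a" "\<And>q. q \<notin> K \<Longrightarrow> \<psi> q = 0"
      unfolding bump_in_def by blast
    have off: "h \<psi> q = 0" if "q \<notin> K" for q by (simp add: h_def K(3)[OF that])
    have "h \<psi> p * dvg M w p + dfun M (h \<psi>) p (w p) =
       indicator (fst a) p * (h \<psi> p * coord_div M a w (snd a p) + dfun M (h \<psi>) p (w p))" for p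
    proof (cases "p \<in> fst a")
      case True then show ?thesis by (simp add: dvg_chart[OF w a(1)])
    next
      case False
      then have "p \<notin> K" using K(2) by blast
      then have "dfun M (h \<psi>) p (w p) = 0"
        using dfun_zero[of "- K" p "h \<psi>"] off compact_imp_closed[OF K(1)] by (simp add: open_Compl)
      then show ?thesis using \<open>p \<notin> K\<close> off False by simp
    qed
    then show ?thesis
      using chart_integration_by_parts(2)[OF w a(1) h[OF mem] K(1,2) off] by simp
  qed
  have split: "(LINT p|vol M. h \<psi> p * dvg M w p) = - (LINT p|vol M. dfun M (h \<psi>) p (w p))" if "\<psi> \<in> I" for \<psi>
    using zero[OF that] cont[OF that] by (simp add: integrable_continuous eq_neg_iff_add_eq_0)
  have "(LINT p|vol M. f p * dvg M w p) = (LINT p|vol M. (\<Sum>\<psi>\<in>I. h \<psi> p * dvg M w p))"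
    by (simp add: sum_h[symmetric] sum_distrib_right)
  also have "\<dots> = (\<Sum>\<psi>\<in>I. (LINT p|vol M. h \<psi> p * dvg M w p))"
    by (rule Bochner_Integration.integral_sum) (rule integrable_continuous[OF cont(1)])
  also have "\<dots> = - (\<Sum>\<psi>\<in>I. (LINT p|vol M. dfun M (h \<psi>) p (w p)))"
    by (simp add: split sum_negf)
  also have "(\<Sum>\<psi>\<in>I. (LINT p|vol M. dfun M (h \<psi>) p (w p))) = (LINT p|vol M. (\<Sum>\<psi>\<in>I. dfun M (h \<psi>) p (w p)))"
    by (rule Bochner_Integration.integral_sum[symmetric]) (rule integrable_continuous[OF cont(2)])
  also have "\<dots> = (LINT p|vol M. dfun M f p (w p))"
  proof -
    have "dfun M (\<lambda>p. \<Sum>\<psi>\<in>I. h \<psi> p) p u = (\<Sum>\<psi>\<in>I. dfun M (h \<psi>) p u)" for p u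
      by (rule dfun_sum[OF h])
    then show ?thesis by (simp add: sum_h)
  qed
  finally show ?thesis .
qed

section \<open>Onsager's principle and the Wasserstein gradient flow\<close>

lemma metric_coord:
  assumes "a \<in> atlas M" "x \<in> chart_image a"
  shows "metric M (chart_inv a x) (v (chart_inv a x)) (w (chart_inv a x)) =
    coord_field M a v x \<bullet> (gram M a x *v coord_field M a w x)"
  using metric_gram[OF assms, of "coord_field M a v x" "coord_field M a w x"] assms
  by (simp add: coord_field_def)

lemma metric_continuous:
  assumes "smooth_field M v" "smooth_field M w"
  shows "continuous_on UNIV (\<lambda>p. metric M p (v p) (w p))"
proof (rule continuous_onI_charts)
  fix a assume a: "a \<in> atlas M"
  have "continuous_on (chart_image a) (\<lambda>x. \<Sum>i\<in>UNIV. coord_field M a v x $ i *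
      (\<Sum>j\<in>UNIV. gram M a x $ i $ j * coord_field M a w x $ j))"
    by (intro continuous_intros ck_on_imp_continuous_on[OF smooth_field_comp[OF assms(1) a]]
      ck_on_imp_continuous_on[OF smooth_field_comp[OF assms(2) a]] ck_on_imp_continuous_on[OF gram_ck[OF a]])
  then show "continuous_on (chart_image a) ((\<lambda>p. metric M p (v p) (w p)) \<circ> chart_inv a)"
    by (simp add: metric_coord[OF a] inner_vec_def matrix_vector_mult_def cong: continuous_on_cong)
qed

lemma smooth_fun_const: "smooth_fun M (\<lambda>_. r)"
  by (simp add: smooth_fun_iff ck_fun_const)

lemma smooth_fun_continuous: "smooth_fun M f \<Longrightarrow> continuous_on UNIV f"
  using ck_fun_continuous by (auto simp: smooth_fun_iff)

lemma scale_tangential: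
  assumes "smooth_fun M f" "w \<in> tangential_fields M"
  shows "(\<lambda>p. f p *\<^sub>R w p) \<in> tangential_fields M"
  using assms scale_smooth_field by (auto simp: tangential_fields_def metric_simps)

lemma neg_tangential:
  assumes "w \<in> tangential_fields M"
  shows "(\<lambda>p. - w p) \<in> tangential_fields M"
  using scale_tangential[OF smooth_fun_const[of "-1"] assms] by simp

lemma dfun_const: "dfun M (\<lambda>_. r) p u = 0"
  using dfun_eqI[of "\<lambda>_. r" p "\<lambda>_. 0"] by (simp add: o_def)

lemma grad_add_const:
  assumes "smooth_fun M f"
  shows "grad M (\<lambda>p. f p + r) = grad M f"
proof -
  have "dfun M (\<lambda>p. f p + r) p = dfun M f p" for p
  proof (rule dfun_eqI)
    have "ck_fun (Suc 0) f" using assms by (simp add: smooth_fun_iff)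
    from has_derivative_add_const[OF dfun_deriv[OF this], of p r]
    show "((\<lambda>p. f p + r) \<circ> chart_inv (chart_at M p) has_derivative dfun M f p)
        (at (snd (chart_at M p) p) within half_space)"
      by (simp add: o_def)
  qed
  then show ?thesis by (simp add: grad_def fun_eq_iff)
qed

lemma dvg_minus:
  assumes w: "w \<in> tangential_fields M"
  shows "dvg M (\<lambda>p. - w p) p = - dvg M w p"
proof -
  define a where "a = chart_at M p"
  have a: "a \<in> atlas M" "snd a p \<in> chart_image a" using chart_at by (auto simp: a_def)
  have ws: "smooth_field M w" using w by (simp add: tangential_fields_def)
  let ?X = "\<lambda>i y. vol_density M a y * coord_field M a w y $ i"
  have "pd i (\<lambda>y. vol_density M a y * coord_field M a (\<lambda>p. - w p) y $ i) (snd a p) = - pd i (?X i) (snd a p)" for i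
  proof -
    have "pd i (\<lambda>y. vol_density M a y * coord_field M a (\<lambda>p. - w p) y $ i) (snd a p)
        = pd i (\<lambda>y. - ?X i y) (snd a p)"
      by (rule pd_cong[OF hopen_image[OF a(1)] a(2)])
        (simp add: coord_field_def linear_neg[OF linear_to_chart[OF a(1)]] a(1))
    also have "\<dots> = - pd i (?X i) (snd a p)"
      using pd_eq[OF has_derivative_minus[OF ck_on_deriv[OF hopen_image[OF a(1)] flux_ck[OF ws a(1)] a(2)]]
          image_subset_half_space[OF a]] by (simp add: pd_def)
    finally show ?thesis .
  qed
  then show ?thesis
    by (simp add: dvg_def a_def[symmetric] coord_div_eq[OF a] sum_negf)
qed

lemma transport_tangent:
  assumes c: "smooth_fun M c" and w: "w \<in> tangential_fields M"
  shows "transport M c w \<in> tangents M"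
proof -
  note cw = scale_tangential[OF c w]
  have "smooth_fun M (transport M c w)"
    using dvg_smooth[OF cw] by (simp add: transport_def smooth_fun_iff ck_fun_minus)
  moreover have "(LINT p|vol M. transport M c w p) = 0"
    using integration_by_parts[OF cw ck_fun_const[of _ 1]] by (simp add: transport_def dfun_const)
  ultimately show ?thesis by (simp add: tangents_def)
qed

lemma integral_transport:
  assumes c: "smooth_fun M c" and w: "w \<in> tangential_fields M" and f: "smooth_fun M f"
  shows "(LINT p|vol M. f p * transport M c w p) = (LINT p|vol M. c p * metric M p (grad M f p) (w p))"
proof -
  have ck: "ck_fun (Suc 0) f" using f by (simp add: smooth_fun_iff)
  have "(LINT p|vol M. f p * transport M c w p) = (LINT p|vol M. dfun M f p (c p *\<^sub>R w p))"
    using integration_by_parts[OF scale_tangential[OF c w] ck] by (simp add: transport_def)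
  then show ?thesis by (simp add: metric_grad[OF ck, symmetric] metric_simps)
qed

lemma neumann_tangential:
  assumes "neumann_solution M c h C"
  shows "grad M C \<in> tangential_fields M"
  using assms grad_smooth_field by (auto simp: neumann_solution_def tangential_fields_def)

lemma neumann_transport:
  assumes "neumann_solution M c h C"
  shows "transport M c (grad M C) = h"
  using assms by (auto simp: neumann_solution_def transport_def)

text \<open>Integration by parts turns the product into \<open>\<integral> C\<^sub>1 h\<^sub>2 dV\<close>, and by symmetry into \<open>\<integral> C\<^sub>2 h\<^sub>1 dV\<close>. The
  first form does not see the choice of \<open>C\<^sub>2\<close>, the second not that of \<open>C\<^sub>1\<close>.\<close>
lemma wasserstein_eq:
  assumes c: "smooth_fun M c" and C1: "neumann_solution M c h1 C1" and C2: "neumann_solution M c h2 C2"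
  shows "wasserstein M c h1 h2 = (LINT p|vol M. C1 p * h2 p)"
proof -
  have inner: "(LINT p|vol M. c p * metric M p (grad M D1 p) (grad M D2 p)) = (LINT p|vol M. D1 p * k2 p)"
    if "neumann_solution M c k1 D1" "neumann_solution M c k2 D2" for k1 k2 D1 D2
    using integral_transport[OF c neumann_tangential[OF that(2)], of D1] that
    by (simp add: neumann_transport[OF that(2)] neumann_solution_def)
  have sym: "(LINT p|vol M. D1 p * k2 p) = (LINT p|vol M. D2 p * k1 p)"
    if "neumann_solution M c k1 D1" "neumann_solution M c k2 D2" for k1 k2 D1 D2
    using inner[OF that] inner[OF that(2,1)] by (simp add: metric_sym)
  show ?thesis
    unfolding wasserstein_def
  proof (rule the_equality)
    show "\<exists>D1 D2. neumann_solution M c h1 D1 \<and> neumann_solution M c h2 D2 \<and>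
        (LINT p|vol M. C1 p * h2 p) = (LINT p|vol M. c p * metric M p (grad M D1 p) (grad M D2 p))"
      using inner[OF C1 C2] C1 C2 by metis
    fix r
    assume "\<exists>C1 C2. neumann_solution M c h1 C1 \<and> neumann_solution M c h2 C2 \<and>
        r = (LINT p|vol M. c p * metric M p (grad M C1 p) (grad M C2 p))"
    then obtain D1 D2 where D: "neumann_solution M c h1 D1" "neumann_solution M c h2 D2"
      and r: "r = (LINT p|vol M. D1 p * h2 p)" using inner by metis
    show "r = (LINT p|vol M. C1 p * h2 p)"
      unfolding r using sym[OF D(1) C2] sym[OF C1 C2] by simp
  qed
qed

text \<open>With \<open>s = v + \<nabla>C\<close>, the Rayleighian at \<open>v\<close> exceeds its value at the admissible field \<open>-\<nabla>C\<close> by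
  half of \<open>\<integral> c g(s, s) dV\<close>, so this integral is zero for a minimizer, and its continuous nonnegative integrand
  vanishes.\<close>
lemma rayleighian_minimizer:
  assumes c: "smooth_fun M c" "\<And>p. 0 \<le> c p"
    and C: "smooth_fun M C" "grad M C \<in> tangential_fields M"
    and L: "\<And>w. w \<in> tangential_fields M \<Longrightarrow>
      L c (transport M c w) = (LINT p|vol M. c p * metric M p (grad M C p) (w p))"
    and v: "is_arg_min (rayleighian L (dissipation M) (transport M) c) (\<lambda>w. w \<in> tangential_fields M) v"
  shows "c p *\<^sub>R v p = - (c p *\<^sub>R grad M C p)"
proof -
  let ?R = "rayleighian L (dissipation M) (transport M) c"
  let ?u = "grad M C"
  have vt: "v \<in> tangential_fields M" using v by (simp add: is_arg_min_def)
  have nt: "(\<lambda>p. - ?u p) \<in> tangential_fields M" by (rule neg_tangential[OF C(2)])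
  have le: "?R v \<le> ?R (\<lambda>p. - ?u p)" using v nt by (force simp: is_arg_min_def not_less)
  have sm: "smooth_field M v" "smooth_field M ?u" using vt C(2) by (auto simp: tangential_fields_def)
  have int: "integrable (vol M) (\<lambda>p. c p * metric M p (x p) (y p))"
    if "smooth_field M x" "smooth_field M y" for x y
    by (intro integrable_continuous continuous_on_mult smooth_fun_continuous[OF c(1)] metric_continuous that)
  define s where "s p = v p + ?u p" for p
  have ss: "smooth_field M s" unfolding s_def by (rule add_smooth_field[OF sm])
  have expand: "c p * metric M p (s p) (s p) = c p * metric M p (v p) (v p) +
      2 * (c p * metric M p (?u p) (v p)) + c p * metric M p (?u p) (?u p)" for p
    using metric_sym[of p "v p" "?u p"] by (simp add: s_def metric_simps algebra_simps)
  have "(LINT p|vol M. c p * metric M p (s p) (s p)) = 2 * (?R v - ?R (\<lambda>p. - ?u p))"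
    unfolding rayleighian_def L[OF vt] L[OF nt] dissipation_def expand
    using int[OF sm(1) sm(1)] int[OF sm(2) sm(1)] int[OF sm(2) sm(2)] by (simp add: metric_simps)
  then have "(LINT p|vol M. c p * metric M p (s p) (s p)) \<le> 0" using le by simp
  moreover have "0 \<le> c p * metric M p (s p) (s p)" for p using c(2) metric_nonneg by simp
  ultimately have "c p * metric M p (s p) (s p) = 0"
    using smooth_fun_continuous[OF c(1)] metric_continuous[OF ss ss]
    by (intro integral_zero_imp_zero[where g = "\<lambda>p. c p * metric M p (s p) (s p)"] continuous_on_mult antisym)
      (auto intro: Bochner_Integration.integral_nonneg)
  then have "c p = 0 \<or> s p = 0" using metric_pos[of "s p" p] by force
  then show ?thesis by (auto simp: s_def eq_neg_iff_add_eq_0 simp flip: scaleR_add_right)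
qed

text \<open>The function minus its mean value is a tangent vector, so it is orthogonal to \<open>f\<close>. It is also orthogonal to
  constants, hence to itself.\<close>
lemma orthogonal_tangents_constant:
  assumes f: "smooth_fun M f" and orth: "\<And>h. h \<in> tangents M \<Longrightarrow> (LINT p|vol M. f p * h p) = 0"
  shows "\<exists>m. \<forall>p. f p = m"
proof -
  define V where "V = measure (vol M) UNIV"
  have "V \<noteq> 0"
    using integral_zero_imp_zero[of "\<lambda>_. 1 :: real"] by (auto simp: V_def)
  define m where "m = (LINT p|vol M. f p) / V"
  define h where "h p = f p + - m" for p
  have hs: "smooth_fun M h"
    using f unfolding h_def by (simp only: smooth_fun_iff) (intro allI ck_fun_add ck_fun_const, simp)
  have i: "integrable (vol M) f" "integrable (vol M) h" "integrable (vol M) (\<lambda>p. f p * h p)"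
      "integrable (vol M) (\<lambda>p. - m)"
    by (intro integrable_continuous continuous_on_mult smooth_fun_continuous f hs continuous_on_const)+
  have h0: "(LINT p|vol M. h p) = 0"
    unfolding h_def Bochner_Integration.integral_add[OF i(1,4)]
    using \<open>V \<noteq> 0\<close> by (simp add: m_def V_def)
  then have "h \<in> tangents M" using hs by (simp add: tangents_def)
  from orth[OF this] h0 i have "(LINT p|vol M. f p * h p + - m * h p) = 0"
    by (subst Bochner_Integration.integral_add) auto
  then have "(LINT p|vol M. h p * h p) = 0"
    by (simp add: h_def algebra_simps)
  then have "h p * h p = 0" for p
    by (intro integral_zero_imp_zero[where g = "\<lambda>p. h p * h p"] continuous_on_mult smooth_fun_continuous hs) auto
  then show ?thesis by (intro exI[of _ m]) (simp add: h_def)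
qed

text \<open>Time enters the variational principle only through the density at that time.\<close>
lemma onsager_wasserstein:
  assumes c: "c \<in> densities M"
    and G2: "is_grad_L2 M F c G" and GW: "is_grad_W M F c H"
    and neumann: "\<And>h. h \<in> tangents M \<Longrightarrow> \<exists>C. neumann_solution M c h C"
    and v: "is_arg_min (rayleighian (dF M F) (dissipation M) (transport M) c) (\<lambda>w. w \<in> tangential_fields M) v"
  shows "transport M c v = (\<lambda>p. - H p)"
    and "(\<lambda>p. - H p) = dvg M (\<lambda>p. c p *\<^sub>R grad M G p)"
proof -
  have cs: "smooth_fun M c" "\<And>p. 0 \<le> c p" using c by (auto simp: densities_def)
  have H: "H \<in> tangents M" using GW by (simp add: is_grad_W_def)
  then obtain C where C: "neumann_solution M c H C" using neumann by blast
  have Cs: "smooth_fun M C" using C by (simp add: neumann_solution_def)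
  have Gs: "smooth_fun M G" using G2 by (simp add: is_grad_L2_def)
  note Ct = neumann_tangential[OF C]
  have dF: "dF M F c h = (LINT p|vol M. C p * h p)" if h: "h \<in> tangents M" for h
  proof -
    obtain C2 where "neumann_solution M c h C2" using neumann[OF h] by blast
    from wasserstein_eq[OF cs(1) C this] GW h show ?thesis by (simp add: is_grad_W_def)
  qed
  have cC: "(\<lambda>p. - H p) = dvg M (\<lambda>p. c p *\<^sub>R grad M C p)"
    using neumann_transport[OF C] by (auto simp: transport_def)
  have "c p *\<^sub>R v p = - (c p *\<^sub>R grad M C p)" for p
  proof (rule rayleighian_minimizer[OF cs Cs Ct _ v])
    show "dF M F c (transport M c w) = (LINT p|vol M. c p * metric M p (grad M C p) (w p))"
      if "w \<in> tangential_fields M" for w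
      using dF[OF transport_tangent[OF cs(1) that]] integral_transport[OF cs(1) that Cs] by simp
  qed
  then show "transport M c v = (\<lambda>p. - H p)"
    unfolding cC transport_def using dvg_minus[OF scale_tangential[OF cs(1) Ct]] by simp
  have "\<exists>m. \<forall>p. C p + - G p = m"
  proof (rule orthogonal_tangents_constant)
    show "smooth_fun M (\<lambda>p. C p + - G p)"
      using Cs Gs by (simp only: smooth_fun_iff) (intro allI ck_fun_add ck_fun_minus, auto)
    fix h assume h: "h \<in> tangents M"
    have hs: "smooth_fun M h" using h by (simp add: tangents_def)
    have "integrable (vol M) (\<lambda>p. C p * h p)" "integrable (vol M) (\<lambda>p. G p * h p)"
      by (intro integrable_continuous continuous_on_mult smooth_fun_continuous Cs Gs hs)+
    moreover have "(LINT p|vol M. C p * h p) = (LINT p|vol M. G p * h p)"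
      using dF[OF h] G2 h by (simp add: is_grad_L2_def)
    ultimately show "(LINT p|vol M. (C p + - G p) * h p) = 0"
      by (simp add: left_diff_distrib)
  qed
  then obtain m where m: "\<And>p. C p + - G p = m" by blast
  have "C = (\<lambda>p. G p + m)"
  proof
    show "C p = G p + m" for p using m[of p] by simp
  qed
  then have "grad M C = grad M G" using grad_add_const[OF Gs] by simp
  then show "(\<lambda>p. - H p) = dvg M (\<lambda>p. c p *\<^sub>R grad M G p)" using cC by simp
qed

end

theorem corollary2p1:
  fixes M :: "('m::{t2_space, second_countable_topology}, 'n::finite) riem"
    and F :: "('m \<Rightarrow> real) \<Rightarrow> real"
    and T :: "real set"
    and c c' grad_L2 grad_W :: "real \<Rightarrow> 'm \<Rightarrow> real"
  assumes "riemannian_manifold M"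
    and "compact (UNIV :: 'm set)"
    and "is_interval T" and "interior T \<noteq> {}"
    and "ovp_solution (densities M) (dF M F) (\<lambda>_. tangential_fields M) (dissipation M) (transport M)
           T c c'"
    and "\<And>t. t \<in> T \<Longrightarrow> energy_differentiable M F (c t)"
    and "\<And>t. t \<in> T \<Longrightarrow> is_grad_L2 M F (c t) (grad_L2 t)"
    and "\<And>t. t \<in> T \<Longrightarrow> is_grad_W M F (c t) (grad_W t)"
    and "\<And>t h. t \<in> T \<Longrightarrow> h \<in> tangents M \<Longrightarrow> \<exists>C. neumann_solution M (c t) h C"
  shows "\<forall>t\<in>T. c' t = (\<lambda>p. - grad_W t p) \<and>
    (\<lambda>p. - grad_W t p) = dvg M (\<lambda>p. c t p *\<^sub>R grad M (grad_L2 t) p)"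
proof
  interpret compact_riemannian M by unfold_locales (fact assms)+
  fix t assume t: "t \<in> T"
  obtain v where c: "c t \<in> densities M" and c': "c' t = transport M (c t) v"
    and v: "is_arg_min (rayleighian (dF M F) (dissipation M) (transport M) (c t))
      (\<lambda>w. w \<in> tangential_fields M) v"
    using assms(5) t by (auto simp: ovp_solution_def)
  show "c' t = (\<lambda>p. - grad_W t p) \<and>
      (\<lambda>p. - grad_W t p) = dvg M (\<lambda>p. c t p *\<^sub>R grad M (grad_L2 t) p)"
    unfolding c' using onsager_wasserstein[OF c assms(7)[OF t] assms(8)[OF t] assms(9)[OF t] v] by simp
qed

end
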